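(* Let $X$ be a perfect Hausdorff uniform space and let $G$ be a topologically free subgroup of $\mathrm{Aut}(X)$. Then $(X,G)$ is amenable if and only if $$\sup_{E\in\mathcal{F}(G)}\ \sup_{\mathcal{U}\in\mathcal{N}(X)}\ \inf\left\{\frac{N\left(\bigvee_{g\in E}g(\mathcal{V})\right)}{N(\mathcal{V})}\ \middle|\ \mathcal{V}\in\mathcal{N}(X),\ \mathcal{U}\preceq\mathcal{V}\right\}=1.$$
   Context: Set notation: $\mathcal{P}(X)$ is the power set of $X$ and $\mathcal{F}(G)$ the set of finite subsets of $G$. For $\mathcal{U},\mathcal{V}\subseteq\mathcal{P}(X)$, write $\mathcal{U}\preceq\mathcal{V}$ ("$\mathcal{V}$ refines $\mathcal{U}$") if every $V\in\mathcal{V}$ is contained in some $U\in\mathcal{U}$. For a family $(\mathcal{U}_i)_{i\in I}$ of subsets of $\mathcal{P}(X)$, $\bigvee_{i\in I}\mathcal{U}_i=\{\bigcap_{i\in I}U_i\mid (U_i)_{i\in I}\in\prod_{i\in I}\mathcal{U}_i\}$ (the empty intersection being $X$). For $S\subseteq X$ put $\mathrm{St}(S,\mathcal{U})=\bigcup\{U\in\mathcal{U}\mid U\cap S\neq\emptyset\}$, $\mathrm{St}(x,\mathcal{U})=\mathrm{St}(\{x\},\mathcal{U})$, and $\mathcal{U}^{\ast}=\{\mathrm{St}(U,\mathcal{U})\mid U\in\mathcal{U}\}$; write $\mathcal{U}\preceq^{\ast}\mathcal{V}$ if $\mathcal{U}\preceq\mathcal{V}^{\ast}$. A covering of $X$ is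 a $\mathcal{U}\subseteq\mathcal{P}(X)$ with $\bigcup\mathcal{U}=X$. Uniform spaces (via coverings): a uniformity on $X$ is a non-empty set $\mathcal{D}$ of coverings of $X$ such that (1) if $\mathcal{U}\in\mathcal{D}$ and $\mathcal{V}$ is a covering of $X$ with $\mathcal{V}\preceq\mathcal{U}$, then $\mathcal{V}\in\mathcal{D}$; (2) for all $\mathcal{U},\mathcal{V}\in\mathcal{D}$ there is $\mathcal{W}\in\mathcal{D}$ with $\mathcal{U}\preceq^{\ast}\mathcal{W}$ and $\mathcal{V}\preceq^{\ast}\mathcal{W}$. A uniform space is a non-empty set $X$ with a uniformity, whose elements are called uniform coverings. $\mathcal{N}(X)$ is the set of finite uniform coverings of $X$. The topology of $X$: $S\subseteq X$ is open iff for every $x\in S$ there is a uniform covering $\mathcal{U}$ with $\mathrm{St}(x,\mathcal{U})\subseteq S$. "Perfect" means that this topology has no isolated points, and "Hausdorff" and "dense" refer to this topology. A map $f\colon X\to Y$ of uniform spaces is uniformly continuous if $f^{-1}(\mathcal{U})=\{f^{-1}(U)\mid U\in\mathcal{U}\}$ is a uniform covering of $X$ for each uniform covering $\mathcal{U}$ of $Y$. $\mathrm{Aut}(X)$ is the group of bijections $X\to X$ that are uniformly continuous with uniformly continuous inverse. For $g\in\mathrm{Aut}(X)$, $g(\mathcal{V})=\{g(V)\mid V\in\mathcal{V}\}$. A subgroup $G$ of $\mathrm{Aut}(X)$ is topologically free if for every $E\in\mathcal{F}(G)$ the set $\{x\in X\mid \forall g\in E\setminus\{\mathrm{id}_X\}\colon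 g(x)\neq x\}$ is dense in $X$. Amenability: $UC_b(X)$ is the space of bounded uniformly continuous functions $X\to\mathbb{R}$ ($\mathbb{R}$ with its usual metric uniformity). A mean on $UC_b(X)$ is a linear map $m\colon UC_b(X)\to\mathbb{R}$ with $\inf_{x\in X} f(x)\leq m(f)\leq\sup_{x\in X} f(x)$ for all $f$. $(X,G)$ is amenable if there is a mean $m$ on $UC_b(X)$ with $m(f\circ g)=m(f)$ for all $f\in UC_b(X)$, $g\in G$. Uniform complexity: for $\mathcal{U}\in\mathcal{N}(X)$, $N(\mathcal{U})=\inf\{|\mathcal{V}|\mid\mathcal{V}\in\mathcal{N}(X),\ \mathcal{U}\preceq\mathcal{V}\}$. *)

theory Defs
  imports
    "HOL-Analysis.Analysis"
    "HOL-Algebra.Group"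
    "HOL-Library.Extended_Real"
begin

text \<open>The underlying non-empty set of a uniform space is the universe of a type. We follow the
  definition of uniform spaces by uniform coverings (Tukey, Isbell), whereas the library class
  \<open>uniform_space\<close> is based on entourages.\<close>

definition covering :: "'a set set \<Rightarrow> bool" where
  "covering \<U> \<longleftrightarrow> \<Union>\<U> = UNIV"

text \<open>The finer family stands on the right.\<close>

definition refined_by :: "'a set set \<Rightarrow> 'a set set \<Rightarrow> bool" (infix "\<preceq>" 50) where
  "\<U> \<preceq> \<V> \<longleftrightarrow> (\<forall>V\<in>\<V>. \<exists>U\<in>\<U>. V \<subseteq> U)"

definition cover_join :: "'i set \<Rightarrow> ('i \<Rightarrow> 'a set set) \<Rightarrow> 'a set set" where
  "cover_join I \<U> = {\<Inter>i\<in>I. U i | U. U \<in> Pi\<^sub>E I \<U>}"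

definition star_of :: "'a set \<Rightarrow> 'a set set \<Rightarrow> 'a set" where
  "star_of S \<U> = \<Union>{U \<in> \<U>. U \<inter> S \<noteq> {}}"

definition star_family :: "'a set set \<Rightarrow> 'a set set" where
  "star_family \<U> = {star_of U \<U> | U. U \<in> \<U>}"

definition star_refined_by :: "'a set set \<Rightarrow> 'a set set \<Rightarrow> bool" (infix "\<preceq>\<^sup>*" 50) where
  "\<U> \<preceq>\<^sup>* \<V> \<longleftrightarrow> \<U> \<preceq> star_family \<V>"

definition covering_uniformity :: "'a set set set \<Rightarrow> bool" where
  "covering_uniformity D \<longleftrightarrow>
     D \<noteq> {} \<and>
     (\<forall>\<U>\<in>D. covering \<U>) \<and>
     (\<forall>\<U>\<in>D. \<forall>\<V>. covering \<V> \<and> \<V> \<preceq> \<U> \<longrightarrow> \<V> \<in> D) \<and>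
     (\<forall>\<U>\<in>D. \<forall>\<V>\<in>D. \<exists>\<W>\<in>D. \<U> \<preceq>\<^sup>* \<W> \<and> \<V> \<preceq>\<^sup>* \<W>)"

definition finite_uniform_coverings :: "'a set set set \<Rightarrow> 'a set set set" where
  "finite_uniform_coverings D = {\<U> \<in> D. finite \<U>}"

definition uniform_topology :: "'a set set set \<Rightarrow> 'a topology" where
  "uniform_topology D = topology (\<lambda>S. \<forall>x\<in>S. \<exists>\<U>\<in>D. star_of {x} \<U> \<subseteq> S)"

lemma star_of_mono:
  assumes "\<U> \<preceq>\<^sup>* \<W>" "covering \<W>"
  shows "star_of {x} \<W> \<subseteq> star_of {x} \<U>"
proof
  fix y assume "y \<in> star_of {x} \<W>"
  then obtain W where W: "W \<in> \<W>" "x \<in> W" "y \<in> W" by (auto simp: star_of_def)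
  then have "W \<subseteq> star_of W \<W>" by (auto simp: star_of_def)
  moreover obtain U where U: "U \<in> \<U>" "star_of W \<W> \<subseteq> U"
    using assms(1) W(1) by (auto simp: star_refined_by_def refined_by_def star_family_def)
  ultimately have "x \<in> U" "y \<in> U" "U \<in> \<U>" using W U by auto
  then show "y \<in> star_of {x} \<U>" by (auto simp: star_of_def)
qed

lemma openin_uniform_topology:
  assumes "covering_uniformity D"
  shows "openin (uniform_topology D) S \<longleftrightarrow> (\<forall>x\<in>S. \<exists>\<U>\<in>D. star_of {x} \<U> \<subseteq> S)"
proof -
  have "istopology (\<lambda>S. \<forall>x\<in>S. \<exists>\<U>\<in>D. star_of {x} \<U> \<subseteq> S)"
    unfolding istopology_def
  proof (intro conjI allI impI ballI)
    fix S T x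
    assume S: "\<forall>x\<in>S. \<exists>\<U>\<in>D. star_of {x} \<U> \<subseteq> S" and T: "\<forall>x\<in>T. \<exists>\<U>\<in>D. star_of {x} \<U> \<subseteq> T"
      and x: "x \<in> S \<inter> T"
    obtain \<U> \<V> where UV: "\<U> \<in> D" "star_of {x} \<U> \<subseteq> S" "\<V> \<in> D" "star_of {x} \<V> \<subseteq> T"
      using S T x by blast
    then obtain \<W> where W: "\<W> \<in> D" "\<U> \<preceq>\<^sup>* \<W>" "\<V> \<preceq>\<^sup>* \<W>"
      using assms unfolding covering_uniformity_def by blast
    moreover have "covering \<W>" using W assms unfolding covering_uniformity_def by blast
    ultimately show "\<exists>\<U>\<in>D. star_of {x} \<U> \<subseteq> S \<inter> T"
      using UV star_of_mono by (metis Int_greatest subset_trans)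
  next
    fix K x
    assume "\<forall>S\<in>K. \<forall>x\<in>S. \<exists>\<U>\<in>D. star_of {x} \<U> \<subseteq> S" "x \<in> \<Union>K"
    then show "\<exists>\<U>\<in>D. star_of {x} \<U> \<subseteq> \<Union>K" by (meson Sup_upper UnionE subset_trans)
  qed
  then show ?thesis unfolding uniform_topology_def by (simp add: topology_inverse')
qed

lemma topspace_uniform_topology:
  assumes "covering_uniformity D"
  shows "topspace (uniform_topology D) = UNIV"
proof -
  have "openin (uniform_topology D) UNIV"
    using assms by (auto simp: openin_uniform_topology) (auto simp: covering_uniformity_def)
  then show ?thesis using openin_subset by blast
qed

definition perfect_topology :: "'a topology \<Rightarrow> bool" where
  "perfect_topology T \<longleftrightarrow> (\<forall>x\<in>topspace T. \<not> openin T {x})"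

definition unif_continuous :: "'a set set set \<Rightarrow> 'b set set set \<Rightarrow> ('a \<Rightarrow> 'b) \<Rightarrow> bool" where
  "unif_continuous D D' f \<longleftrightarrow> (\<forall>\<U>\<in>D'. {f -` U | U. U \<in> \<U>} \<in> D)"

definition Aut :: "'a set set set \<Rightarrow> ('a \<Rightarrow> 'a) monoid" where
  "Aut D = \<lparr>carrier = {g. bij g \<and> unif_continuous D D g \<and> unif_continuous D D (inv_into UNIV g)},
            mult = (\<circ>), one = id\<rparr>"

lemma unif_continuous_id: "unif_continuous D D id"
  by (simp add: unif_continuous_def)

lemma unif_continuous_comp:
  assumes "unif_continuous D D' f" "unif_continuous D' D'' g"
  shows "unif_continuous D D'' (g \<circ> f)"
  unfolding unif_continuous_def
proof
  fix \<U> assume "\<U> \<in> D''"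
  then have "{f -` V | V. V \<in> {g -` U | U. U \<in> \<U>}} \<in> D"
    using assms unfolding unif_continuous_def by blast
  moreover have "{f -` V | V. V \<in> {g -` U | U. U \<in> \<U>}} = {(g \<circ> f) -` U | U. U \<in> \<U>}"
    unfolding vimage_comp[symmetric] by blast
  ultimately show "{(g \<circ> f) -` U | U. U \<in> \<U>} \<in> D" by simp
qed

lemma group_Aut: "group (Aut D)"
proof (rule groupI)
  fix g h assume "g \<in> carrier (Aut D)" "h \<in> carrier (Aut D)"
  then show "g \<otimes>\<^bsub>Aut D\<^esub> h \<in> carrier (Aut D)"
    by (auto simp: Aut_def bij_comp o_inv_distrib intro: unif_continuous_comp)
next
  fix g assume g: "g \<in> carrier (Aut D)"
  then have "inv_into UNIV g \<in> carrier (Aut D)"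
    by (simp add: Aut_def bij_imp_bij_inv inv_inv_eq)
  moreover have "inv_into UNIV g \<otimes>\<^bsub>Aut D\<^esub> g = \<one>\<^bsub>Aut D\<^esub>"
    using g by (simp add: Aut_def bij_is_inj)
  ultimately show "\<exists>y\<in>carrier (Aut D). y \<otimes>\<^bsub>Aut D\<^esub> g = \<one>\<^bsub>Aut D\<^esub>" by blast
qed (auto simp: Aut_def unif_continuous_id o_assoc inv_id)

definition topologically_free :: "'a set set set \<Rightarrow> ('a \<Rightarrow> 'a) set \<Rightarrow> bool" where
  "topologically_free D G \<longleftrightarrow>
     (\<forall>E. finite E \<and> E \<subseteq> G \<longrightarrow>
        uniform_topology D closure_of {x. \<forall>g\<in>E - {id}. g x \<noteq> x} = topspace (uniform_topology D))"

text \<open>The uniform coverings of a metric space are those having a Lebesgue number.\<close>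

definition metric_uniformity :: "'b::metric_space set set set" where
  "metric_uniformity = {\<U>. covering \<U> \<and> (\<exists>e>0. \<U> \<preceq> {ball x e | x. True})}"

definition UC_b :: "'a set set set \<Rightarrow> ('a \<Rightarrow> real) set" where
  "UC_b D = {f. unif_continuous D metric_uniformity f \<and> bounded (range f)}"

text \<open>Only the values of a mean on \<^const>\<open>UC_b\<close> matter.\<close>

definition is_mean :: "'a set set set \<Rightarrow> (('a \<Rightarrow> real) \<Rightarrow> real) \<Rightarrow> bool" where
  "is_mean D m \<longleftrightarrow>
     (\<forall>f\<in>UC_b D. \<forall>h\<in>UC_b D. m (\<lambda>x. f x + h x) = m f + m h) \<and>
     (\<forall>f\<in>UC_b D. \<forall>c. m (\<lambda>x. c * f x) = c * m f) \<and>
     (\<forall>f\<in>UC_b D. (INF x. f x) \<le> m f \<and> m f \<le> (SUP x. f x))"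

definition amenable :: "'a set set set \<Rightarrow> ('a \<Rightarrow> 'a) set \<Rightarrow> bool" where
  "amenable D G \<longleftrightarrow> (\<exists>m. is_mean D m \<and> (\<forall>f\<in>UC_b D. \<forall>g\<in>G. m (f \<circ> g) = m f))"

definition uniform_complexity :: "'a set set set \<Rightarrow> 'a set set \<Rightarrow> nat" where
  "uniform_complexity D \<U> = Inf {card \<V> | \<V>. \<V> \<in> finite_uniform_coverings D \<and> \<U> \<preceq> \<V>}"

definition image_family :: "('a \<Rightarrow> 'b) \<Rightarrow> 'a set set \<Rightarrow> 'b set set" where
  "image_family g \<V> = {g ` V | V. V \<in> \<V>}"

end

theory Submission
  imports Defs
begin

text \<open>Why amenability is the same as slow growth of the uniform complexity \<open>N\<close>: both say that for
  finitely many \<open>g\<close> some finite family of points is, up to a small proportion and up to a prescribed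
  uniform covering, permuted by \<open>g\<close>. The translation is Koenig's theorem (\<open>koenig\<close>): in a finite
  bipartite graph some matching has as many edges as a smallest vertex cover has vertices, so a
  large lower bound for vertex covers produces the almost-permutations.

  From slow growth to a mean. Let \<open>N (\<Or>g\<in>E. g \<X>) \<le> (1 + e) * N \<X>\<close>, let \<open>\<W>\<close> be a smallest
  finite uniform covering refining that join, and suppose that \<open>E\<close> contains the identity and the
  inverse of \<open>g\<close>. Then \<open>\<W>\<close> and \<open>g \<W>\<close> both refine \<open>\<X>\<close>. Join \<open>A\<close> and \<open>B\<close> in \<open>\<W>\<close> by an edge if \<open>A\<close> meets
  \<open>g B\<close>. The sets named by a vertex cover form a uniform covering that refines \<open>\<X>\<close>, so a vertex cover
  has at least \<open>N \<X>\<close> vertices, and a matching misses only a small part of \<open>\<W>\<close>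
  (\<open>large_matching_of_refinement\<close>). Choose a point in every member of \<open>\<W>\<close>. Matched points are close,
  hence the average of a bounded uniformly continuous function over these points hardly changes
  under \<open>g\<close> (\<open>almost_invariant_finite_average\<close>), and a limit of such averages is an invariant mean.

  From a mean to slow growth. An invariant mean \<open>m\<close> vanishes on \<open>f \<circ> g - f\<close>. Points \<open>p\<^sub>0, p\<^sub>1, \<dots>\<close> can
  then be chosen greedily so that the sums of finitely many such differences over the first \<open>n\<close>
  points are of order \<open>sqrt n\<close>. Each choice only has to satisfy one strict inequality, so it can be
  made in a non-empty open set; perfectness and topological freeness allow all the points
  \<open>g p\<^sub>i\<close> to be distinct (\<open>generic_averaging_points\<close>). With the \<open>f\<close> taken from a Urysohn lemma for uniform
  coverings (\<open>uniform_urysohn\<close>), Koenig's theorem matches all but order \<open>sqrt n\<close> of the points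
  \<open>g p\<^sub>k\<close> with nearby points \<open>p\<^sub>i\<close> (\<open>almost_perfect_matchings\<close>).

  Now build a covering \<open>\<W>\<close> with \<open>n\<close> special members, the \<open>i\<close>-th of which owns precisely the
  points \<open>g p\<^sub>k\<close> matched with \<open>p\<^sub>i\<close>, and boundedly many members that avoid all these points. Put
  \<open>\<X> = (\<Union>g\<in>E. g\<^sup>-\<^sup>1 \<W>)\<close>. Then \<open>\<W>\<close> refines \<open>g \<X>\<close> for every \<open>g\<close> in \<open>E\<close>, which bounds the complexity of the
  join by \<open>n\<close> plus a constant; and no member of \<open>\<X>\<close> contains two points \<open>p\<^sub>k\<close> that are matched under
  every \<open>g\<close>, which bounds \<open>N \<X>\<close> below by \<open>n\<close> minus order \<open>sqrt n\<close> (\<open>covering_from_matchings\<close>). For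
  large \<open>n\<close> the quotient is close to one.\<close>

section \<open>Koenig's theorem for finite bipartite graphs\<close>

definition vertex_cover :: "('a \<times> 'b) set \<Rightarrow> 'a set \<Rightarrow> 'b set \<Rightarrow> bool" where
  "vertex_cover R S T \<longleftrightarrow> finite S \<and> finite T \<and> (\<forall>(a, b)\<in>R. a \<in> S \<or> b \<in> T)"

text \<open>Uncrossing, the only place where bipartiteness enters: exchanging intersections and unions
  on opposite sides keeps every edge covered. The two deleted edges are covered by \<open>T \<union> T'\<close>, since
  \<open>a\<close> is in neither \<open>S\<close> nor \<open>S'\<close> and so \<open>b\<close> is in \<open>T'\<close> and \<open>b'\<close> is in \<open>T\<close>; on the other side they cost
  the single extra vertex \<open>a\<close>.\<close>

lemma vertex_cover_uncross:
  assumes "vertex_cover (R - {(a, b)}) S T" "vertex_cover (R - {(a, b')}) S' T'"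
    and "(a, b) \<in> R" "(a, b') \<in> R" "b \<noteq> b'" "a \<notin> S" "a \<notin> S'"
  shows "vertex_cover R (S \<inter> S') (T \<union> T')" "vertex_cover R (insert a (S \<union> S')) (T \<inter> T')"
  using assms unfolding vertex_cover_def by auto

text \<open>If every edge is needed to force a vertex cover of size \<open>k\<close>, no two edges share their left
  end: covers of size at most \<open>k - 1\<close> avoiding two such edges would uncross to two vertex covers of
  the whole graph with at most \<open>2 * k - 1\<close> vertices altogether.\<close>

lemma critical_edges_disjoint:
  assumes min: "\<And>S T. vertex_cover R S T \<Longrightarrow> k \<le> card S + card T"
    and crit: "\<And>e. e \<in> R \<Longrightarrow> \<exists>S T. vertex_cover (R - {e}) S T \<and> card S + card T < k"
  shows "inj_on fst R"
proof (rule inj_onI, rule ccontr)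
  fix e f assume ef: "e \<in> R" "f \<in> R" "fst e = fst f" "e \<noteq> f"
  then obtain a b b' where [simp]: "e = (a, b)" "f = (a, b')" and "b \<noteq> b'"
    by (metis prod.collapse)
  obtain S T where ST: "vertex_cover (R - {e}) S T" "card S + card T < k"
    using crit ef(1) by blast
  obtain S' T' where ST': "vertex_cover (R - {f}) S' T'" "card S' + card T' < k"
    using crit ef(2) by blast
  note fin = ST(1)[unfolded vertex_cover_def] ST'(1)[unfolded vertex_cover_def]
  have "a \<notin> S"
  proof
    assume "a \<in> S"
    then have "vertex_cover R S T" using ST(1) by (auto simp: vertex_cover_def)
    then show False using min ST(2) by force
  qed
  moreover have "a \<notin> S'"
  proof
    assume "a \<in> S'"
    then have "vertex_cover R S' T'" using ST'(1) by (auto simp: vertex_cover_def)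
    then show False using min ST'(2) by force
  qed
  ultimately have "vertex_cover R (S \<inter> S') (T \<union> T')"
    "vertex_cover R (insert a (S \<union> S')) (T \<inter> T')"
    using vertex_cover_uncross[of R a b S T b' S' T'] ST ST' ef \<open>b \<noteq> b'\<close> by auto
  then have "k \<le> card (S \<inter> S') + card (T \<union> T')"
    "k \<le> card (insert a (S \<union> S')) + card (T \<inter> T')" using min by blast+
  moreover have "card S + card S' = card (S \<union> S') + card (S \<inter> S')"
    "card T + card T' = card (T \<union> T') + card (T \<inter> T')"
    using fin by (auto intro: card_Un_Int)
  moreover have "card (insert a (S \<union> S')) \<le> Suc (card (S \<union> S'))"
    using fin by (simp add: card_insert_if)
  ultimately show False using ST(2) ST'(2) by linarith
qed

lemma vertex_cover_converse: "vertex_cover (R\<inverse>) S T \<longleftrightarrow> vertex_cover R T S"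
  by (auto simp: vertex_cover_def)

text \<open>Deleting edges as long as the lower bound for vertex covers survives leads to a graph in
  which every edge is critical. Its edges are pairwise disjoint, so it is itself the matching, and
  its left ends are a vertex cover.\<close>

theorem koenig:
  assumes "finite R" "\<And>S T. vertex_cover R S T \<Longrightarrow> k \<le> card S + card T"
  shows "\<exists>M\<subseteq>R. inj_on fst M \<and> inj_on snd M \<and> k \<le> card M"
  using assms
proof (induction R rule: finite_psubset_induct)
  case (psubset R)
  show ?case
  proof (cases "\<exists>e\<in>R. \<forall>S T. vertex_cover (R - {e}) S T \<longrightarrow> k \<le> card S + card T")
    case True
    then obtain e where e: "e \<in> R" "\<forall>S T. vertex_cover (R - {e}) S T \<longrightarrow> k \<le> card S + card T"
      by blast
    then have "\<exists>M\<subseteq>R - {e}. inj_on fst M \<and> inj_on snd M \<and> k \<le> card M"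
      using psubset.IH[of "R - {e}"] by blast
    then show ?thesis by blast
  next
    case False
    then have crit: "\<exists>S T. vertex_cover (R - {e}) S T \<and> card S + card T < k" if "e \<in> R" for e
      using that not_le by blast
    have fst: "inj_on fst R"
      using critical_edges_disjoint[of R k] psubset.prems crit by blast
    have "inj_on fst (R\<inverse>)"
    proof (rule critical_edges_disjoint)
      fix S T assume "vertex_cover (R\<inverse>) S T"
      then show "k \<le> card S + card T"
        using psubset.prems[of T S] by (simp add: vertex_cover_converse)
    next
      fix e assume "e \<in> R\<inverse>"
      then obtain a b where e: "e = (b, a)" "(a, b) \<in> R" by auto
      then obtain S T where "vertex_cover (R - {(a, b)}) S T" "card S + card T < k"
        using crit by blast
      moreover have "R\<inverse> - {e} = (R - {(a, b)})\<inverse>" using e by auto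
      ultimately show "\<exists>S T. vertex_cover (R\<inverse> - {e}) S T \<and> card S + card T < k"
        by (metis vertex_cover_converse add.commute)
    qed
    then have "inj_on snd R"
      by (auto intro!: inj_onI dest: inj_onD[where x = "(c, a)" and y = "(c, b)" for a b c])
    moreover have "vertex_cover R (fst ` R) {}"
      using psubset.hyps by (auto simp: vertex_cover_def intro: rev_image_eqI)
    then have "k \<le> card R" using psubset.prems fst by (fastforce simp: card_image)
    ultimately show ?thesis using fst by blast
  qed
qed

section \<open>Uniform coverings\<close>

text \<open>The entourage of a covering. Refinement turns into inclusion of entourages, and star
  refinement yields compositions of several of them.\<close>

definition near :: "'a set set \<Rightarrow> 'a \<Rightarrow> 'a \<Rightarrow> bool" where
  "near \<U> x y \<longleftrightarrow> (\<exists>U\<in>\<U>. x \<in> U \<and> y \<in> U)"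

lemma nearI: "U \<in> \<U> \<Longrightarrow> x \<in> U \<Longrightarrow> y \<in> U \<Longrightarrow> near \<U> x y"
  by (auto simp: near_def)

lemma near_sym: "near \<U> x y \<Longrightarrow> near \<U> y x"
  by (auto simp: near_def)

lemma near_refined: "\<U> \<preceq> \<V> \<Longrightarrow> near \<V> x y \<Longrightarrow> near \<U> x y"
  unfolding near_def refined_by_def by (meson subsetD)

lemma star_of_near: "star_of {x} \<U> = {y. near \<U> x y}"
  by (auto simp: star_of_def near_def)

lemma refined_by_trans: "\<U> \<preceq> \<V> \<Longrightarrow> \<V> \<preceq> \<W> \<Longrightarrow> \<U> \<preceq> \<W>"
  unfolding refined_by_def by (meson order_trans)

lemma refined_by_refl: "\<U> \<preceq> \<U>"
  by (auto simp: refined_by_def)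

lemma star_refined_by_imp_refined_by: "\<U> \<preceq>\<^sup>* \<W> \<Longrightarrow> \<U> \<preceq> \<W>"
  unfolding star_refined_by_def refined_by_def
proof
  fix W assume *: "\<forall>V\<in>star_family \<W>. \<exists>U\<in>\<U>. V \<subseteq> U" and W: "W \<in> \<W>"
  then obtain U where "U \<in> \<U>" "star_of W \<W> \<subseteq> U" by (auto simp: star_family_def)
  moreover have "W \<subseteq> star_of W \<W>" using W by (auto simp: star_of_def)
  ultimately show "\<exists>U\<in>\<U>. W \<subseteq> U" by blast
qed

lemma star_refined_by_common:
  assumes "\<U> \<preceq>\<^sup>* \<W>" "W \<in> \<W>"
  shows "\<exists>U\<in>\<U>. \<forall>y z. y \<in> W \<longrightarrow> near \<W> y z \<longrightarrow> z \<in> U"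
proof -
  obtain U where U: "U \<in> \<U>" "star_of W \<W> \<subseteq> U"
    using assms by (auto simp: star_refined_by_def refined_by_def star_family_def)
  have "z \<in> U" if "y \<in> W" "near \<W> y z" for y z
    using that U(2) unfolding near_def star_of_def by blast
  then show ?thesis using U(1) by blast
qed

lemma cover_joinI:
  assumes "\<And>i. i \<in> I \<Longrightarrow> U i \<in> \<U> i"
  shows "(\<Inter>i\<in>I. U i) \<in> cover_join I \<U>"
  unfolding cover_join_def mem_Collect_eq
  by (rule exI[of _ "restrict U I"]) (use assms in simp)

lemma cover_join_upper: "i \<in> I \<Longrightarrow> \<U> i \<preceq> cover_join I \<U>"
  unfolding refined_by_def cover_join_def by (fastforce simp: PiE_iff)

lemma cover_join_least:
  assumes "\<And>i. i \<in> I \<Longrightarrow> \<U> i \<preceq> \<W>"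
  shows "cover_join I \<U> \<preceq> \<W>"
  unfolding refined_by_def
proof
  fix W assume "W \<in> \<W>"
  then have "\<forall>i\<in>I. \<exists>U. U \<in> \<U> i \<and> W \<subseteq> U"
    using assms unfolding refined_by_def by meson
  then obtain U where U: "\<forall>i\<in>I. U i \<in> \<U> i \<and> W \<subseteq> U i" by metis
  then have "(\<Inter>i\<in>I. U i) \<in> cover_join I \<U>" by (auto intro: cover_joinI)
  moreover have "W \<subseteq> (\<Inter>i\<in>I. U i)" using U by auto
  ultimately show "\<exists>U\<in>cover_join I \<U>. W \<subseteq> U" by blast
qed

lemma finite_cover_join: "finite I \<Longrightarrow> (\<And>i. i \<in> I \<Longrightarrow> finite (\<U> i)) \<Longrightarrow> finite (cover_join I \<U>)"
  unfolding cover_join_def Setcompr_eq_image by (auto intro: finite_PiE)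

lemma unif_continuous_real_iff:
  assumes "\<And>\<U>. \<U> \<in> D \<Longrightarrow> covering \<U>"
    and "\<And>\<U> \<V>. \<U> \<in> D \<Longrightarrow> covering \<V> \<Longrightarrow> \<V> \<preceq> \<U> \<Longrightarrow> \<V> \<in> D"
  shows "unif_continuous D metric_uniformity (f :: 'a \<Rightarrow> real) \<longleftrightarrow>
    (\<forall>e>0. \<exists>\<U>\<in>D. \<forall>x y. near \<U> x y \<longrightarrow> \<bar>f x - f y\<bar> < e)"
proof
  assume f: "unif_continuous D metric_uniformity f"
  show "\<forall>e>0. \<exists>\<U>\<in>D. \<forall>x y. near \<U> x y \<longrightarrow> \<bar>f x - f y\<bar> < e"
  proof (intro allI impI)
    fix e :: real assume "e > 0"
    define \<B> where "\<B> = {ball x (e / 2) | x :: real. True}"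
    have "x \<in> \<Union>\<B>" for x
    proof
      show "x \<in> ball x (e / 2)" "ball x (e / 2) \<in> \<B>" using \<open>e > 0\<close> by (auto simp: \<B>_def)
    qed
    then have "covering \<B>" unfolding covering_def by blast
    then have "\<B> \<in> metric_uniformity"
      unfolding metric_uniformity_def using \<open>e > 0\<close> refined_by_refl[of \<B>]
      by (auto simp: \<B>_def intro!: exI[of _ "e / 2"])
    then have "{f -` B | B. B \<in> \<B>} \<in> D" using f by (auto simp: unif_continuous_def)
    moreover have "\<bar>f x - f y\<bar> < e" if n: "near {f -` B | B. B \<in> \<B>} x y" for x y
    proof -
      obtain B where "B \<in> \<B>" "f x \<in> B" "f y \<in> B"
        using n by (auto simp: near_def)
      moreover from this obtain c where "B = ball c (e / 2)" by (auto simp: \<B>_def)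
      ultimately have "f x \<in> ball c (e / 2)" "f y \<in> ball c (e / 2)" by auto
      then show ?thesis unfolding mem_ball dist_real_def by linarith
    qed
    ultimately show "\<exists>\<U>\<in>D. \<forall>x y. near \<U> x y \<longrightarrow> \<bar>f x - f y\<bar> < e" by blast
  qed
next
  assume f: "\<forall>e>0. \<exists>\<U>\<in>D. \<forall>x y. near \<U> x y \<longrightarrow> \<bar>f x - f y\<bar> < e"
  show "unif_continuous D metric_uniformity f"
    unfolding unif_continuous_def
  proof
    fix \<B> :: "real set set" assume "\<B> \<in> metric_uniformity"
    then obtain e where B: "\<Union>\<B> = UNIV" "e > 0" "\<B> \<preceq> {ball x e | x. True}"
      by (auto simp: metric_uniformity_def covering_def)
    obtain \<U> where U: "\<U> \<in> D" "\<And>x y. near \<U> x y \<Longrightarrow> \<bar>f x - f y\<bar> < e" using f B(2) by blast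
    have "{f -` B | B. B \<in> \<B>} \<preceq> \<U>"
      unfolding refined_by_def
    proof
      fix U assume "U \<in> \<U>"
      show "\<exists>V\<in>{f -` B | B. B \<in> \<B>}. U \<subseteq> V"
      proof (cases "U = {}")
        case True
        then show ?thesis using B(1) by blast
      next
        case False
        then obtain x where "x \<in> U" by blast
        then have "U \<subseteq> f -` ball (f x) e"
          using \<open>U \<in> \<U>\<close> nearI[of U \<U> x] U(2) by (auto simp: dist_real_def)
        moreover obtain B where "B \<in> \<B>" "ball (f x) e \<subseteq> B"
          using B(3) by (auto simp: refined_by_def)
        ultimately show ?thesis by blast
      qed
    qed
    moreover have "covering {f -` B | B. B \<in> \<B>}" using B(1) unfolding covering_def by blast
    ultimately show "{f -` B | B. B \<in> \<B>} \<in> D" using assms(2) U(1) by blast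
  qed
qed

locale uniform_covering_space =
  fixes D :: "'a set set set"
  assumes uniformity: "covering_uniformity D"
begin

lemma covers: "\<U> \<in> D \<Longrightarrow> \<Union>\<U> = UNIV"
  using uniformity by (auto simp: covering_uniformity_def covering_def)

lemma coveredE:
  assumes "\<U> \<in> D"
  obtains U where "U \<in> \<U>" "x \<in> U"
  using covers[OF assms] by (metis UNIV_I Union_iff)

lemma coarser: "\<U> \<in> D \<Longrightarrow> \<Union>\<V> = UNIV \<Longrightarrow> \<V> \<preceq> \<U> \<Longrightarrow> \<V> \<in> D"
  using uniformity unfolding covering_uniformity_def covering_def by metis

lemma refined_uniform:
  assumes "\<U> \<in> D" "\<V> \<preceq> \<U>"
  shows "\<V> \<in> D"
proof (rule coarser[OF assms(1) _ assms(2)])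
  have "x \<in> \<Union>\<V>" for x
  proof -
    obtain U where "U \<in> \<U>" "x \<in> U" using assms(1) by (rule coveredE)
    then show ?thesis using assms(2) by (auto simp: refined_by_def dest!: bspec)
  qed
  then show "\<Union>\<V> = UNIV" by blast
qed

lemma star_refinement:
  assumes "\<U> \<in> D" "\<V> \<in> D"
  obtains \<W> where "\<W> \<in> D" "\<U> \<preceq>\<^sup>* \<W>" "\<V> \<preceq>\<^sup>* \<W>"
  using uniformity assms unfolding covering_uniformity_def by blast

lemma near_refl: "\<U> \<in> D \<Longrightarrow> near \<U> x x"
  using covers[of \<U>] unfolding near_def by (metis UNIV_I Union_iff)

lemma trivial_covering: "{UNIV} \<in> D"
proof -
  obtain \<U> where "\<U> \<in> D" using uniformity by (auto simp: covering_uniformity_def)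
  then show ?thesis by (rule refined_uniform) (auto simp: refined_by_def)
qed

lemma common_refinement:
  assumes "finite I" "\<And>i. i \<in> I \<Longrightarrow> \<U> i \<in> D"
  shows "\<exists>\<W>\<in>D. \<forall>i\<in>I. \<U> i \<preceq> \<W>"
  using assms
proof (induction I rule: finite_induct)
  case empty
  then show ?case using trivial_covering by blast
next
  case (insert i I)
  then obtain \<W> where W: "\<W> \<in> D" "\<forall>j\<in>I. \<U> j \<preceq> \<W>" by auto
  obtain \<W>' where W': "\<W>' \<in> D" "\<U> i \<preceq>\<^sup>* \<W>'" "\<W> \<preceq>\<^sup>* \<W>'"
    using star_refinement[of "\<U> i" \<W>] W(1) insert.prems by auto
  then show ?case
    using W(2) star_refined_by_imp_refined_by refined_by_trans by (metis insert_iff)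
qed

lemma cover_join_uniform:
  assumes "finite I" "\<And>i. i \<in> I \<Longrightarrow> \<U> i \<in> D"
  shows "cover_join I \<U> \<in> D"
proof -
  obtain \<W> where "\<W> \<in> D" "\<forall>i\<in>I. \<U> i \<preceq> \<W>" using common_refinement[of I \<U>] assms by blast
  then show ?thesis using refined_uniform cover_join_least by metis
qed

text \<open>Here one member \<open>U\<close> serves all two-step neighbours of \<open>x\<close>. This is what makes it possible to label
  the points of the space by members of \<open>\<U>\<close> with some room to spare.\<close>

lemma two_step_refinement:
  assumes "\<U> \<in> D"
  shows "\<exists>\<V>\<in>D. \<forall>x. \<exists>U\<in>\<U>. \<forall>y z. near \<V> x y \<longrightarrow> near \<V> y z \<longrightarrow> z \<in> U"
proof -
  obtain \<W> where W: "\<W> \<in> D" "\<U> \<preceq>\<^sup>* \<W>" using star_refinement[OF assms assms] by blast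
  obtain \<V> where V: "\<V> \<in> D" "\<W> \<preceq>\<^sup>* \<V>" using star_refinement[OF W(1) W(1)] by blast
  have "\<exists>U\<in>\<U>. \<forall>y z. near \<V> x y \<longrightarrow> near \<V> y z \<longrightarrow> z \<in> U" for x
  proof -
    obtain A where A: "A \<in> \<V>" "x \<in> A" using V(1) by (rule coveredE)
    obtain W where W': "W \<in> \<W>" "\<forall>y z. y \<in> A \<longrightarrow> near \<V> y z \<longrightarrow> z \<in> W"
      using star_refined_by_common[OF V(2) A(1)] ..
    obtain U where U: "U \<in> \<U>" "\<forall>y z. y \<in> W \<longrightarrow> near \<W> y z \<longrightarrow> z \<in> U"
      using star_refined_by_common[OF W(2) W'(1)] ..
    have "z \<in> U" if "near \<V> x y" "near \<V> y z" for y z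
      using that A(2) W'(2) U(2) near_refined[OF star_refined_by_imp_refined_by[OF V(2)]] by blast
    then show ?thesis using U(1) by blast
  qed
  then show ?thesis using V(1) by blast
qed

text \<open>Three steps rather than two are what the chain argument in the Urysohn lemma needs.\<close>

lemma three_step_refinement:
  assumes "\<U> \<in> D"
  shows "\<exists>\<V>\<in>D. \<forall>w x y z. near \<V> w x \<longrightarrow> near \<V> x y \<longrightarrow> near \<V> y z \<longrightarrow> near \<U> w z"
proof -
  obtain \<V> where V: "\<V> \<in> D" "\<U> \<preceq>\<^sup>* \<V>" using star_refinement[OF assms assms] by blast
  have "near \<U> w z" if n: "near \<V> w x" "near \<V> x y" "near \<V> y z" for w x y z
  proof -
    obtain A where A: "A \<in> \<V>" "x \<in> A" "y \<in> A" using n(2) by (auto simp: near_def)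
    obtain U where "U \<in> \<U>" "\<forall>y z. y \<in> A \<longrightarrow> near \<V> y z \<longrightarrow> z \<in> U"
      using star_refined_by_common[OF V(2) A(1)] ..
    then have "w \<in> U" "z \<in> U" using A n(3) near_sym[OF n(1)] by simp_all
    then show ?thesis using \<open>U \<in> \<U>\<close> by (auto simp: near_def)
  qed
  then show ?thesis using V(1) by blast
qed

lemma openin_iff: "openin (uniform_topology D) S \<longleftrightarrow> (\<forall>x\<in>S. \<exists>\<U>\<in>D. \<forall>y. near \<U> x y \<longrightarrow> y \<in> S)"
  unfolding openin_uniform_topology[OF uniformity] star_of_near by (simp add: subset_eq)

subsection \<open>Uniform complexity\<close>

lemma uniform_complexity_le:
  "\<V> \<in> finite_uniform_coverings D \<Longrightarrow> \<U> \<preceq> \<V> \<Longrightarrow> uniform_complexity D \<U> \<le> card \<V>"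
  unfolding uniform_complexity_def by (rule cInf_lower) auto

lemma uniform_complexity_attained:
  assumes "\<U> \<in> finite_uniform_coverings D"
  obtains \<V> where "\<V> \<in> finite_uniform_coverings D" "\<U> \<preceq> \<V>" "card \<V> = uniform_complexity D \<U>"
proof -
  have "uniform_complexity D \<U> \<in> {card \<V> | \<V>. \<V> \<in> finite_uniform_coverings D \<and> \<U> \<preceq> \<V>}"
    unfolding uniform_complexity_def
    by (rule Inf_nat_def1) (use assms refined_by_refl in blast)
  then show ?thesis using that by auto
qed

lemma uniform_complexity_mono:
  assumes "\<V> \<in> finite_uniform_coverings D" "\<U> \<preceq> \<V>"
  shows "uniform_complexity D \<U> \<le> uniform_complexity D \<V>"
proof -
  obtain \<W> where "\<W> \<in> finite_uniform_coverings D" "\<V> \<preceq> \<W>" "card \<W> = uniform_complexity D \<V>"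
    using uniform_complexity_attained[OF assms(1)] .
  then show ?thesis using uniform_complexity_le refined_by_trans[OF assms(2)] by metis
qed

lemma uniform_complexity_pos:
  assumes "\<U> \<in> finite_uniform_coverings D"
  shows "uniform_complexity D \<U> > 0"
proof -
  obtain \<V> where V: "\<V> \<in> finite_uniform_coverings D" "card \<V> = uniform_complexity D \<U>"
    using uniform_complexity_attained[OF assms] by blast
  then have "finite \<V>" "\<V> \<in> D" by (auto simp: finite_uniform_coverings_def)
  moreover from this have "\<V> \<noteq> {}" using coveredE by blast
  ultimately show ?thesis using V by (metis card_gt_0_iff)
qed

section \<open>Uniformly continuous functions\<close>

lemma UC_b_iff:
  "f \<in> UC_b D \<longleftrightarrow> (\<forall>e>0. \<exists>\<U>\<in>D. \<forall>x y. near \<U> x y \<longrightarrow> \<bar>f x - f y\<bar> < e) \<and> (\<exists>B. \<forall>x. \<bar>f x\<bar> \<le> B)"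
proof -
  have "unif_continuous D metric_uniformity f \<longleftrightarrow>
      (\<forall>e>0. \<exists>\<U>\<in>D. \<forall>x y. near \<U> x y \<longrightarrow> \<bar>f x - f y\<bar> < e)"
  proof (rule unif_continuous_real_iff)
    show "covering \<U>" if "\<U> \<in> D" for \<U> using covers[OF that] unfolding covering_def .
    show "\<V> \<in> D" if "\<U> \<in> D" "covering \<V>" "\<V> \<preceq> \<U>" for \<U> \<V>
      using that unfolding covering_def by (rule coarser)
  qed
  then show ?thesis by (simp add: UC_b_def bounded_iff)
qed

lemma UC_b_const: "(\<lambda>x. c) \<in> UC_b D"
  unfolding UC_b_iff using trivial_covering by auto

lemma UC_b_add:
  assumes "f \<in> UC_b D" "h \<in> UC_b D"
  shows "(\<lambda>x. f x + h x) \<in> UC_b D"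
  unfolding UC_b_iff
proof (intro conjI allI impI)
  fix e :: real assume "e > 0"
  then obtain \<U> \<V> where U: "\<U> \<in> D" "\<And>x y. near \<U> x y \<Longrightarrow> \<bar>f x - f y\<bar> < e / 2"
    and V: "\<V> \<in> D" "\<And>x y. near \<V> x y \<Longrightarrow> \<bar>h x - h y\<bar> < e / 2"
    using assms unfolding UC_b_iff by (metis half_gt_zero)
  obtain \<W> where W: "\<W> \<in> D" "\<U> \<preceq> \<W>" "\<V> \<preceq> \<W>"
    using star_refinement[OF U(1) V(1)] star_refined_by_imp_refined_by by metis
  have "\<bar>f x + h x - (f y + h y)\<bar> < e" if "near \<W> x y" for x y
    using U(2)[OF near_refined[OF W(2) that]] V(2)[OF near_refined[OF W(3) that]] by linarith
  then show "\<exists>\<U>\<in>D. \<forall>x y. near \<U> x y \<longrightarrow> \<bar>f x + h x - (f y + h y)\<bar> < e" using W(1) by blast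
next
  obtain B C where "\<forall>x. \<bar>f x\<bar> \<le> B" "\<forall>x. \<bar>h x\<bar> \<le> C" using assms by (auto simp: UC_b_iff)
  then have "\<bar>f x + h x\<bar> \<le> B + C" for x
    using abs_triangle_ineq[of "f x" "h x"] add_mono by (metis order_trans)
  then show "\<exists>B. \<forall>x. \<bar>f x + h x\<bar> \<le> B" by blast
qed

lemma UC_b_scale:
  assumes "f \<in> UC_b D"
  shows "(\<lambda>x. c * f x) \<in> UC_b D"
  unfolding UC_b_iff
proof (intro conjI allI impI)
  fix e :: real assume "e > 0"
  then have "e / (\<bar>c\<bar> + 1) > 0" by simp
  then obtain \<U> where U: "\<U> \<in> D" "\<And>x y. near \<U> x y \<Longrightarrow> \<bar>f x - f y\<bar> < e / (\<bar>c\<bar> + 1)"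
    using assms unfolding UC_b_iff by metis
  have "\<bar>c * f x - c * f y\<bar> < e" if "near \<U> x y" for x y
  proof -
    have "\<bar>c * f x - c * f y\<bar> = \<bar>c\<bar> * \<bar>f x - f y\<bar>" by (simp add: abs_mult flip: right_diff_distrib)
    also have "\<dots> \<le> (\<bar>c\<bar> + 1) * \<bar>f x - f y\<bar>" by (intro mult_right_mono) auto
    also have "\<dots> < e" using U(2)[OF that] by (simp add: pos_less_divide_eq mult.commute add_pos_nonneg)
    finally show ?thesis .
  qed
  then show "\<exists>\<U>\<in>D. \<forall>x y. near \<U> x y \<longrightarrow> \<bar>c * f x - c * f y\<bar> < e" using U(1) by blast
next
  obtain B where "\<forall>x. \<bar>f x\<bar> \<le> B" using assms by (auto simp: UC_b_iff)
  then have "\<bar>c * f x\<bar> \<le> \<bar>c\<bar> * B" for x by (simp add: abs_mult mult_left_mono)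
  then show "\<exists>B. \<forall>x. \<bar>c * f x\<bar> \<le> B" by blast
qed

lemma UC_b_sum:
  assumes "finite I" "\<And>i. i \<in> I \<Longrightarrow> f i \<in> UC_b D"
  shows "(\<lambda>x. \<Sum>i\<in>I. f i x) \<in> UC_b D"
  using assms by (induction I rule: finite_induct) (auto intro: UC_b_const UC_b_add)

lemma UC_b_compose:
  assumes "f \<in> UC_b D" "unif_continuous D D g"
  shows "f \<circ> g \<in> UC_b D"
  using assms unif_continuous_comp[of D D g metric_uniformity f]
  unfolding UC_b_def by (auto intro: bounded_subset)

lemma UC_b_open:
  assumes "f \<in> UC_b D"
  shows "openin (uniform_topology D) {x. f x < c}"
  unfolding openin_iff
proof
  fix x assume "x \<in> {x. f x < c}"
  then obtain \<U> where "\<U> \<in> D" "\<And>y. near \<U> x y \<Longrightarrow> \<bar>f x - f y\<bar> < c - f x"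
    using assms unfolding UC_b_iff by (metis diff_gt_0_iff_gt mem_Collect_eq)
  then show "\<exists>\<U>\<in>D. \<forall>y. near \<U> x y \<longrightarrow> y \<in> {x. f x < c}" by fastforce
qed

text \<open>Finitely many short intervals cover the range of \<open>f\<close>, and their preimages form a uniform
  covering. It suffices to use the intervals around the multiples of \<open>d / 2\<close> that are obtained by
  rounding the values of \<open>f\<close>.\<close>

lemma finite_small_oscillation_covering:
  assumes f: "f \<in> UC_b D" and d: "d > 0"
  shows "\<exists>\<U>\<in>finite_uniform_coverings D. \<forall>x y. near \<U> x y \<longrightarrow> \<bar>f x - f y\<bar> \<le> d"
proof -
  \<comment> \<open>Consecutive intervals overlap, so a set of oscillation less than \<open>d / 4\<close> fits into one of them.\<close>
  define I where "I k = {x. \<bar>f x - d / 2 * real_of_int k\<bar> < d / 2}" for k :: int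
  define r where "r x = round (f x / (d / 2))" for x
  have r: "\<bar>f x - d / 2 * real_of_int (r x)\<bar> \<le> d / 4" for x
  proof -
    have "\<bar>real_of_int (r x) - f x / (d / 2)\<bar> \<le> 1 / 2"
      unfolding r_def by (rule of_int_round_abs_le)
    then have "(d / 2) * \<bar>real_of_int (r x) - f x / (d / 2)\<bar> \<le> (d / 2) * (1 / 2)"
      using d by (intro mult_left_mono) auto
    moreover have "(d / 2) * \<bar>real_of_int (r x) - f x / (d / 2)\<bar> = \<bar>f x - d / 2 * real_of_int (r x)\<bar>"
    proof -
      have "(d / 2) * \<bar>real_of_int (r x) - f x / (d / 2)\<bar>
          = \<bar>(d / 2) * (real_of_int (r x) - f x / (d / 2))\<bar>" using d by (simp add: abs_mult)
      also have "(d / 2) * (real_of_int (r x) - f x / (d / 2)) = d / 2 * real_of_int (r x) - f x"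
        using d by (simp add: field_simps)
      finally show ?thesis by (simp add: abs_minus_commute)
    qed
    ultimately show ?thesis by simp
  qed
  obtain B where B: "\<And>x. \<bar>f x\<bar> \<le> B" using f by (auto simp: UC_b_iff)
  have "range r \<subseteq> {- \<lceil>B / (d / 2) + 1\<rceil> .. \<lceil>B / (d / 2) + 1\<rceil>}"
  proof
    fix k assume "k \<in> range r"
    then obtain x where k: "k = r x" by blast
    have "\<bar>real_of_int (r x) - f x / (d / 2)\<bar> \<le> 1 / 2"
      unfolding r_def by (rule of_int_round_abs_le)
    moreover have "\<bar>f x / (d / 2)\<bar> \<le> B / (d / 2)"
      using B[of x] d by (simp add: abs_divide divide_right_mono)
    ultimately have "\<bar>real_of_int k\<bar> \<le> B / (d / 2) + 1" using k by linarith
    then show "k \<in> {- \<lceil>B / (d / 2) + 1\<rceil> .. \<lceil>B / (d / 2) + 1\<rceil>}" 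
      using le_of_int_ceiling[of "B / (d / 2) + 1"] unfolding atLeastAtMost_iff by linarith
  qed
  then have "finite (range r)" by (rule finite_subset) simp
  define \<U> where "\<U> = I ` range r"
  obtain \<V> where V: "\<V> \<in> D" "\<And>x y. near \<V> x y \<Longrightarrow> \<bar>f x - f y\<bar> < d / 4"
    using f d unfolding UC_b_iff by (metis zero_less_divide_iff zero_less_numeral)
  have "\<U> \<preceq> \<V>"
    unfolding refined_by_def
  proof
    fix A assume A: "A \<in> \<V>"
    show "\<exists>U\<in>\<U>. A \<subseteq> U"
    proof (cases "A = {}")
      case True
      then show ?thesis unfolding \<U>_def by blast
    next
      case False
      then obtain x where x: "x \<in> A" by blast
      have "A \<subseteq> I (r x)"
      proof
        fix y assume "y \<in> A"
        then have "\<bar>f x - f y\<bar> < d / 4" using V(2) A x by (auto simp: near_def)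
        then show "y \<in> I (r x)" using r[of x] unfolding I_def mem_Collect_eq by linarith
      qed
      then show ?thesis unfolding \<U>_def by blast
    qed
  qed
  with V(1) have "\<U> \<in> D" by (rule refined_uniform)
  moreover have "finite \<U>" using \<open>finite (range r)\<close> unfolding \<U>_def by blast
  moreover have "\<bar>f x - f y\<bar> \<le> d" if n: "near \<U> x y" for x y
  proof -
    obtain k where "x \<in> I k" "y \<in> I k" using n by (auto simp: near_def \<U>_def)
    then show ?thesis unfolding I_def mem_Collect_eq by linarith
  qed
  ultimately show ?thesis unfolding finite_uniform_coverings_def by blast
qed

lemma finite_common_small_oscillation_covering:
  assumes "finite F" "F \<subseteq> UC_b D" "d > 0"
  shows "\<exists>\<U>\<in>finite_uniform_coverings D. \<forall>f\<in>F. \<forall>x y. near \<U> x y \<longrightarrow> \<bar>f x - f y\<bar> \<le> d"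
proof -
  have "\<forall>f\<in>F. \<exists>\<U>. \<U> \<in> D \<and> finite \<U> \<and> (\<forall>x y. near \<U> x y \<longrightarrow> \<bar>f x - f y\<bar> \<le> d)"
    using finite_small_oscillation_covering assms unfolding finite_uniform_coverings_def by blast
  then obtain \<U> where U: "\<And>f. f \<in> F \<Longrightarrow> \<U> f \<in> D" "\<And>f. f \<in> F \<Longrightarrow> finite (\<U> f)"
    "\<And>f x y. f \<in> F \<Longrightarrow> near (\<U> f) x y \<Longrightarrow> \<bar>f x - f y\<bar> \<le> d" by metis
  have "cover_join F \<U> \<in> finite_uniform_coverings D"
    using cover_join_uniform[of F \<U>] finite_cover_join[of F \<U>] U assms(1)
    by (auto simp: finite_uniform_coverings_def)
  then show ?thesis using U(3) cover_join_upper near_refined by metis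
qed

end

section \<open>A Urysohn lemma for uniform coverings\<close>

text \<open>Chains and their weights are those of the metrization lemma for uniformities: a step inside a
  member of the \<open>n\<close>-th covering costs \<open>(1 / 2) ^ n\<close>, and the distance of two points is the infimum of
  the costs of the chains that join them.\<close>

fun chain :: "(nat \<Rightarrow> 'a set set) \<Rightarrow> 'a \<Rightarrow> nat list \<Rightarrow> 'a \<Rightarrow> bool" where
  "chain \<U> x [] y \<longleftrightarrow> x = y"
| "chain \<U> x (n # ns) y \<longleftrightarrow> (\<exists>z. near (\<U> n) x z \<and> chain \<U> z ns y)"

definition weight :: "nat list \<Rightarrow> real" where
  "weight ns = (\<Sum>n\<leftarrow>ns. (1 / 2) ^ n)"

lemma weight_simps [simp]:
  "weight [] = 0" "weight (n # ns) = (1 / 2) ^ n + weight ns" "weight (ms @ ns) = weight ms + weight ns"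
  by (simp_all add: weight_def)

lemma weight_nonneg: "weight ns \<ge> 0"
  by (induction ns) auto

lemma chain_append: "chain \<U> x (ms @ ns) y \<longleftrightarrow> (\<exists>z. chain \<U> x ms z \<and> chain \<U> z ns y)"
  by (induction ms arbitrary: x) auto

text \<open>For \<open>t\<close> half of the weight of a chain, this singles out the step that carries it past the middle:
  what precedes and what follows that step weighs at most one half each.\<close>

lemma weight_split:
  assumes "0 \<le> t" "t < weight ns"
  shows "\<exists>as k bs. ns = as @ k # bs \<and> weight as \<le> t \<and> t < weight as + (1 / 2) ^ k"
  using assms
proof (induction ns arbitrary: t)
  case Nil
  then show ?case by simp
next
  case (Cons n ns)
  show ?case
  proof (cases "t < (1 / 2) ^ n")
    case True
    then show ?thesis using Cons.prems(1) by (intro exI[of _ "[]"] exI[of _ n] exI[of _ ns]) simp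
  next
    case False
    then obtain as k bs where "ns = as @ k # bs" "weight as \<le> t - (1 / 2) ^ n"
      "t - (1 / 2) ^ n < weight as + (1 / 2) ^ k"
      using Cons.IH[of "t - (1 / 2) ^ n"] Cons.prems(2) by auto
    then show ?thesis by (intro exI[of _ "n # as"] exI[of _ k] exI[of _ bs]) simp
  qed
qed

text \<open>The metrization lemma. A chain of weight less than \<open>(1 / 2) ^ N\<close> is cut at the middle of its
  weight into two light chains, to which induction applies with \<open>Suc N\<close>, and one step, whose index
  must be at least \<open>Suc N\<close>. Three steps at level \<open>Suc N\<close> make one at level \<open>N\<close>.\<close>

lemma chain_near:
  assumes refl: "\<And>n x. near (\<U> n) x x"
    and three: "\<And>n w x y z. near (\<U> (Suc n)) w x \<Longrightarrow> near (\<U> (Suc n)) x y \<Longrightarrow>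
      near (\<U> (Suc n)) y z \<Longrightarrow> near (\<U> n) w z"
    and "chain \<U> x ns y" "weight ns < (1 / 2) ^ N"
  shows "near (\<U> N) x y"
  using assms(3,4)
proof (induction "length ns" arbitrary: ns x y N rule: less_induct)
  case less
  have mono: "near (\<U> m) x y" if "near (\<U> k) x y" "m \<le> k" for m k x y
    using that(2,1) by (induction rule: inc_induct) (use three refl in blast)+
  show ?case
  proof (cases "ns = []")
    case True
    then show ?thesis using less.prems refl by simp
  next
    case False
    then have "weight ns > 0" by (cases ns) (auto simp: weight_nonneg add_pos_nonneg)
    then obtain as k bs where ns: "ns = as @ k # bs" and w: "weight as \<le> weight ns / 2"
      "weight ns / 2 < weight as + (1 / 2) ^ k"
      using weight_split[of "weight ns / 2" ns] by auto
    obtain u v where uv: "chain \<U> x as u" "near (\<U> k) u v" "chain \<U> v bs y"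
      using less.prems(1) by (auto simp: ns chain_append)
    have half: "(1 / 2 :: real) ^ Suc N = (1 / 2) ^ N / 2" by simp
    have "weight as < (1 / 2) ^ Suc N" "weight bs < (1 / 2) ^ Suc N"
      using w less.prems(2) half by (simp_all add: ns)
    then have "near (\<U> (Suc N)) x u" "near (\<U> (Suc N)) v y"
      using less.hyps[of as x u "Suc N"] less.hyps[of bs v y "Suc N"] uv by (simp_all add: ns)
    moreover have "(1 / 2 :: real) ^ k < (1 / 2) ^ N"
      using less.prems(2) weight_nonneg[of as] weight_nonneg[of bs]
      unfolding ns weight_simps by linarith
    then have "Suc N \<le> k" by (simp add: power_strict_decreasing_iff)
    then have "near (\<U> (Suc N)) u v" using mono uv(2) by blast
    ultimately show ?thesis using three by blast
  qed
qed

context uniform_covering_space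
begin

text \<open>The function is one minus the chain distance from \<open>A\<close>, truncated at one, for a sequence of
  coverings that starts with \<open>\<V>\<close>. A point at distance less than one from \<open>A\<close> is joined to \<open>A\<close> by a
  chain of weight less than \<open>(1 / 2) ^ 0\<close>, hence is near \<open>A\<close> with respect to \<open>\<V>\<close>.\<close>

lemma uniform_urysohn:
  assumes V: "\<V> \<in> D"
  shows "\<exists>h\<in>UC_b D. (\<forall>x. 0 \<le> h x \<and> h x \<le> 1) \<and> (\<forall>x\<in>A. h x = 1) \<and>
    (\<forall>x. h x \<noteq> 0 \<longrightarrow> (\<exists>a\<in>A. near \<V> a x))"
proof -
  have "\<exists>\<U>. \<forall>n. (\<U> n \<in> D \<and> (n = 0 \<longrightarrow> \<U> n = \<V>)) \<and>
    (\<forall>w x y z. near (\<U> (Suc n)) w x \<longrightarrow> near (\<U> (Suc n)) x y \<longrightarrow> near (\<U> (Suc n)) y z \<longrightarrow> near (\<U> n) w z)"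
  proof (rule dependent_nat_choice)
    show "\<exists>\<U>. \<U> \<in> D \<and> (0 = 0 \<longrightarrow> \<U> = \<V>)" using V by blast
    show "\<exists>\<W>. (\<W> \<in> D \<and> (Suc n = 0 \<longrightarrow> \<W> = \<V>)) \<and>
      (\<forall>w x y z. near \<W> w x \<longrightarrow> near \<W> x y \<longrightarrow> near \<W> y z \<longrightarrow> near \<U> w z)"
      if "\<U> \<in> D \<and> (n = 0 \<longrightarrow> \<U> = \<V>)" for \<U> n
      using three_step_refinement[of \<U>] that by auto
  qed
  then obtain \<U> where U: "\<And>n. \<U> n \<in> D" "\<U> 0 = \<V>"
    and three: "\<And>n w x y z. near (\<U> (Suc n)) w x \<Longrightarrow> near (\<U> (Suc n)) x y \<Longrightarrow>
      near (\<U> (Suc n)) y z \<Longrightarrow> near (\<U> n) w z" by metis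
  \<comment> \<open>Inserting one truncates the distance and covers points that no chain reaches.\<close>
  define S where "S x = insert 1 {weight ns | ns a. a \<in> A \<and> chain \<U> a ns x}" for x
  define d where "d x = Inf (S x)" for x
  have S: "s \<ge> 0" if "s \<in> S x" for s x using that by (auto simp: S_def weight_nonneg)
  have bdd: "bdd_below (S x)" for x using S by (auto simp: bdd_below_def)
  have d_le: "d x \<le> s" if "s \<in> S x" for s x unfolding d_def by (rule cInf_lower[OF that bdd])
  have d_ge: "c \<le> d x" if "\<And>s. s \<in> S x \<Longrightarrow> c \<le> s" for c x
    unfolding d_def by (rule cInf_greatest) (use that in \<open>auto simp: S_def\<close>)
  have d01: "0 \<le> d x" "d x \<le> 1" for x
    using d_ge[of x 0] S d_le[of 1 x] by (auto simp: S_def)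
  have lip: "d y \<le> d x + (1 / 2) ^ n" if n: "near (\<U> n) x y" for x y n
  proof -
    have "d y - (1 / 2) ^ n \<le> s" if "s \<in> S x" for s
    proof (cases "s = 1")
      case True
      then show ?thesis using d01(2)[of y] by (simp add: diff_le_eq add_increasing2)
    next
      case False
      then obtain ns a where s: "s = weight ns" "a \<in> A" "chain \<U> a ns x"
        using \<open>s \<in> S x\<close> by (auto simp: S_def)
      then have "chain \<U> a (ns @ [n]) y" using n by (auto simp: chain_append)
      then have "weight (ns @ [n]) \<in> S y" unfolding S_def using s(2) by blast
      then show ?thesis using d_le[of "weight (ns @ [n])" y] s(1) by simp
    qed
    then show ?thesis using d_ge[of x "d y - (1 / 2) ^ n"] by simp
  qed
  define h where "h x = 1 - d x" for x
  have h01: "0 \<le> h x" "h x \<le> 1" for x using d01[of x] by (auto simp: h_def)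
  have "h \<in> UC_b D"
    unfolding UC_b_iff
  proof (intro conjI allI impI)
    fix e :: real assume "e > 0"
    then obtain n where n: "(1 / 2 :: real) ^ n < e" using real_arch_pow_inv[of e "1 / 2"] by auto
    have "\<bar>h x - h y\<bar> < e" if "near (\<U> n) x y" for x y
      using lip[OF that] lip[OF near_sym[OF that]] n by (simp add: h_def abs_less_iff)
    then show "\<exists>\<U>\<in>D. \<forall>x y. near \<U> x y \<longrightarrow> \<bar>h x - h y\<bar> < e" using U(1) by blast
  next
    show "\<exists>B. \<forall>x. \<bar>h x\<bar> \<le> B" using h01 by (intro exI[of _ 1]) auto
  qed
  moreover have "h x = 1" if "x \<in> A" for x
  proof -
    have "weight [] \<in> S x" unfolding S_def using that by (intro insertI2 CollectI exI[of _ "[]"] exI[of _ x]) auto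
    then show ?thesis using d_le[of 0 x] d01(1)[of x] by (simp add: h_def)
  qed
  moreover have "\<exists>a\<in>A. near \<V> a x" if "h x \<noteq> 0" for x
  proof -
    have "\<not> 1 \<le> d x" using that d01(2)[of x] by (auto simp: h_def)
    then obtain s where "s \<in> S x" "s < 1" using d_ge[of x 1] by force
    then obtain ns a where "a \<in> A" "chain \<U> a ns x" "weight ns < (1 / 2) ^ 0" by (auto simp: S_def)
    then show ?thesis
      using chain_near[of \<U> a ns x 0] three near_refl U by auto
  qed
  ultimately show ?thesis using h01 by blast
qed

section \<open>Generic points that average to zero\<close>

lemma mean_add: "is_mean D m \<Longrightarrow> f \<in> UC_b D \<Longrightarrow> h \<in> UC_b D \<Longrightarrow> m (\<lambda>x. f x + h x) = m f + m h"
  and mean_scale: "is_mean D m \<Longrightarrow> f \<in> UC_b D \<Longrightarrow> m (\<lambda>x. c * f x) = c * m f"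
  by (simp_all add: is_mean_def)

lemma mean_sum:
  assumes m: "is_mean D m" and "finite I" "\<And>i. i \<in> I \<Longrightarrow> f i \<in> UC_b D"
  shows "m (\<lambda>x. \<Sum>i\<in>I. f i x) = (\<Sum>i\<in>I. m (f i))"
  using assms(2,3)
proof (induction I rule: finite_induct)
  case empty
  show ?case using mean_scale[OF m UC_b_const[of 0], of 0] by simp
next
  case (insert i I)
  have "m (\<lambda>x. f i x + (\<Sum>i\<in>I. f i x)) = m (f i) + m (\<lambda>x. \<Sum>i\<in>I. f i x)"
    using m insert.prems UC_b_sum[of I f] insert.hyps by (intro mean_add) auto
  then show ?case using insert by simp
qed

lemma mean_less:
  assumes "is_mean D m" "f \<in> UC_b D" "m f < c"
  shows "\<exists>x. f x < c"
proof (rule ccontr)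
  assume "\<nexists>x. f x < c"
  then have "c \<le> (INF x. f x)" by (intro cINF_greatest) (auto simp: not_less)
  then show False using assms by (auto simp: is_mean_def dest: bspec[of _ _ f])
qed

end

locale uniform_action = uniform_covering_space D for D :: "'a set set set" +
  fixes G :: "('a \<Rightarrow> 'a) set"
  assumes subgroup_Aut: "subgroup G (Aut D)"
begin

lemma action_bij: "g \<in> G \<Longrightarrow> bij g"
  and action_unif_continuous: "g \<in> G \<Longrightarrow> unif_continuous D D g"
  using subgroup.subset[OF subgroup_Aut] by (auto simp: Aut_def)

lemma action_comp: "g \<in> G \<Longrightarrow> h \<in> G \<Longrightarrow> g \<circ> h \<in> G"
  using subgroup.m_closed[OF subgroup_Aut, of g h] by (simp add: Aut_def)

lemma action_id: "id \<in> G"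
  using subgroup.one_closed[OF subgroup_Aut] by (simp add: Aut_def)

lemma action_inv:
  assumes "g \<in> G"
  shows "inv_into UNIV g \<in> G"
proof -
  have g: "g \<in> carrier (Aut D)" using assms subgroup.subset[OF subgroup_Aut] by blast
  then have "inv_into UNIV g \<in> carrier (Aut D)" by (simp add: Aut_def bij_imp_bij_inv inv_inv_eq)
  then have "inv\<^bsub>Aut D\<^esub> g = inv_into UNIV g"
    using g by (intro group.inv_equality[OF group_Aut]) (auto simp: Aut_def bij_is_inj)
  then show ?thesis using subgroup.m_inv_closed[OF subgroup_Aut assms] by simp
qed

lemma action_inv_simps [simp]:
  assumes "g \<in> G"
  shows "g (inv_into UNIV g x) = x" "inv_into UNIV g (g x) = x" "inv_into UNIV (inv_into UNIV g) = g"
  using action_bij[OF assms] by (simp_all add: bij_is_surj surj_f_inv_f bij_is_inj inv_inv_eq)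

lemma action_eq_iff: "g \<in> G \<Longrightarrow> g x = g y \<longleftrightarrow> x = y"
  using action_bij by (meson bij_is_inj injD)

lemma vimage_family_uniform:
  "g \<in> G \<Longrightarrow> \<U> \<in> D \<Longrightarrow> {g -` U | U. U \<in> \<U>} \<in> D"
  using action_unif_continuous by (auto simp: unif_continuous_def)

lemma image_family_uniform:
  assumes "g \<in> G" "\<U> \<in> D"
  shows "image_family g \<U> \<in> D"
proof -
  have "image_family g \<U> = {inv_into UNIV g -` U | U. U \<in> \<U>}"
    unfolding image_family_def using action_bij[OF assms(1)] by (simp add: bij_vimage_eq_inv_image action_bij[OF action_inv[OF assms(1)]] assms(1))
  then show ?thesis using vimage_family_uniform[OF action_inv[OF assms(1)] assms(2)] by simp
qed

lemma cover_join_image_finite_uniform: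
  assumes "finite E" "E \<subseteq> G" "\<V> \<in> finite_uniform_coverings D"
  shows "cover_join E (\<lambda>g. image_family g \<V>) \<in> finite_uniform_coverings D"
proof -
  have "finite (image_family g \<V>)" for g
    using assms(3) by (simp add: image_family_def finite_uniform_coverings_def)
  moreover have "image_family g \<V> \<in> D" if "g \<in> E" for g
    using image_family_uniform assms that by (auto simp: finite_uniform_coverings_def)
  ultimately show ?thesis
    using assms(1) by (auto simp: finite_uniform_coverings_def intro: finite_cover_join cover_join_uniform)
qed

end

locale free_perfect_action = uniform_action +
  assumes perfect: "perfect_topology (uniform_topology D)"
    and Hausdorff: "Hausdorff_space (uniform_topology D)"
    and free: "topologically_free D G"
begin

lemma openin_diff_finite:
  assumes "openin (uniform_topology D) S" "finite F"
  shows "openin (uniform_topology D) (S - F)"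
proof -
  have "closedin (uniform_topology D) F"
    using Hausdorff_imp_t1_space[OF Hausdorff] assms(2)
    by (simp add: t1_space_closedin_finite topspace_uniform_topology[OF uniformity])
  then show ?thesis using assms(1) by (rule openin_diff[rotated])
qed

lemma open_infinite:
  assumes "openin (uniform_topology D) S" "S \<noteq> {}"
  shows "infinite S"
proof
  assume "finite S"
  obtain x where "x \<in> S" using assms(2) by blast
  then have "S - (S - {x}) = {x}" by blast
  then have "openin (uniform_topology D) {x}"
    using openin_diff_finite[OF assms(1), of "S - {x}"] \<open>finite S\<close> by simp
  then show False
    using perfect by (simp add: perfect_topology_def topspace_uniform_topology[OF uniformity])
qed

text \<open>Removing \<open>F\<close> leaves a non-empty open set by perfectness, and density of the points moved by all
  \<open>h\<^sup>-\<^sup>1 \<circ> g\<close> other than the identity provides a point at which the members of \<open>E\<close> take distinct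
  values.\<close>

lemma generic_point:
  assumes "openin (uniform_topology D) S" "S \<noteq> {}" "finite F" "finite E" "E \<subseteq> G"
  shows "\<exists>x\<in>S - F. inj_on (\<lambda>g. g x) E"
proof -
  define E' where "E' = (\<lambda>(h, g). inv_into UNIV h \<circ> g) ` (E \<times> E)"
  have "finite E'" "E' \<subseteq> G" using assms(4,5) by (auto simp: E'_def intro!: action_comp action_inv)
  then have dense: "uniform_topology D closure_of {x. \<forall>k\<in>E' - {id}. k x \<noteq> x} = UNIV"
    using free topspace_uniform_topology[OF uniformity] by (simp add: topologically_free_def)
  have "openin (uniform_topology D) (S - F)" by (rule openin_diff_finite) fact+
  moreover have "S - F \<noteq> {}" using open_infinite[OF assms(1,2)] assms(3) by (metis Diff_eq_empty_iff finite_subset)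
  ultimately obtain x where x: "x \<in> S - F" "\<forall>k\<in>E' - {id}. k x \<noteq> x"
    using dense unfolding topspace_uniform_topology[OF uniformity, symmetric] dense_intersects_open
    by blast
  have "inj_on (\<lambda>g. g x) E"
  proof (rule inj_onI)
    fix g h assume gh: "g \<in> E" "h \<in> E" "g x = h x"
    then have G: "g \<in> G" "h \<in> G" using assms(5) by auto
    then have "(inv_into UNIV h \<circ> g) x = x" using gh(3) by simp
    moreover have "inv_into UNIV h \<circ> g \<in> E'" using gh by (auto simp: E'_def)
    ultimately have "inv_into UNIV h \<circ> g = id" using x(2) by blast
    then have "inv_into UNIV h (g y) = y" for y by (metis comp_apply id_apply)
    then have "g y = h y" for y using action_inv_simps(1)[OF G(2)] by metis
    then show "g = h" by blast
  qed
  then show ?thesis using x(1) by blast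
qed

text \<open>The points are chosen greedily. If \<open>s i\<close> is the current sum of \<open>f i\<close>, adding a point \<open>x\<close> changes
  the sum of the squares by \<open>2 * (\<Sum>i\<in>I. s i * f i x)\<close> plus a bounded term. The linear combination in
  the middle has mean zero, so it is less than one somewhere, and then on a non-empty open set in which
  a generic \<open>x\<close> can be found.\<close>

lemma generic_averaging_points:
  fixes f :: "'i \<Rightarrow> 'a \<Rightarrow> real"
  assumes m: "is_mean D m" and I: "finite I" and f: "\<And>i. i \<in> I \<Longrightarrow> f i \<in> UC_b D"
    and m0: "\<And>i. i \<in> I \<Longrightarrow> m (f i) = 0" and B: "\<And>i x. i \<in> I \<Longrightarrow> \<bar>f i x\<bar> \<le> B"
    and E: "finite E" "E \<subseteq> G"
  shows "\<exists>p. inj_on (\<lambda>(g, j). g (p j)) (E \<times> {..<n}) \<and>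
    (\<Sum>i\<in>I. (\<Sum>j<n. f i (p j))\<^sup>2) \<le> real n * (2 + real (card I) * B\<^sup>2)"
proof (induction n)
  case 0
  then show ?case by (auto intro: exI)
next
  case (Suc n)
  then obtain p where p: "inj_on (\<lambda>(g, j). g (p j)) (E \<times> {..<n})"
    "(\<Sum>i\<in>I. (\<Sum>j<n. f i (p j))\<^sup>2) \<le> real n * (2 + real (card I) * B\<^sup>2)" by blast
  define s where "s i = (\<Sum>j<n. f i (p j))" for i
  define \<phi> where "\<phi> x = (\<Sum>i\<in>I. s i * f i x)" for x
  have "\<phi> \<in> UC_b D" unfolding \<phi>_def using I f by (intro UC_b_sum UC_b_scale)
  moreover have "m \<phi> = 0"
  proof -
    have "m \<phi> = (\<Sum>i\<in>I. m (\<lambda>x. s i * f i x))"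
      unfolding \<phi>_def using mean_sum[OF m I, of "\<lambda>i x. s i * f i x"] UC_b_scale f by blast
    also have "\<dots> = (\<Sum>i\<in>I. s i * m (f i))"
      using m f by (intro sum.cong mean_scale) auto
    finally show ?thesis using m0 by simp
  qed
  \<comment> \<open>The bound has to be positive, as a function of mean zero need not take negative values.\<close>
  ultimately have "openin (uniform_topology D) {x. \<phi> x < 1}" "{x. \<phi> x < 1} \<noteq> {}"
    using UC_b_open mean_less[OF m, of \<phi> 1] by auto
  \<comment> \<open>A new point outside \<open>F\<close> has no translate in common with the earlier points.\<close>
  moreover define F where "F = (\<lambda>(g, h, j). inv_into UNIV g (h (p j))) ` (E \<times> E \<times> {..<n})"
  ultimately obtain x where x: "\<phi> x < 1" "x \<notin> F" "inj_on (\<lambda>g. g x) E"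
    using generic_point[of "{x. \<phi> x < 1}" F E] E by (auto simp: F_def)
  have avoid: "g x \<noteq> h (p j)" if "g \<in> E" "h \<in> E" "j < n" for g h j
  proof
    assume "g x = h (p j)"
    then have "x = inv_into UNIV g (h (p j))" using that(1) E(2) by (metis action_inv_simps(2) subsetD)
    then show False using x(2) that unfolding F_def by force
  qed
  let ?q = "p(n := x)"
  have "inj_on (\<lambda>(g, j). g (?q j)) (E \<times> {..<Suc n})"
  proof (rule inj_onI, clarify)
    fix g j h k assume *: "g \<in> E" "h \<in> E" "j < Suc n" "k < Suc n" "g (?q j) = h (?q k)"
    consider "j < n" "k < n" | "j = n" "k < n" | "j < n" "k = n" | "j = n" "k = n"
      using * by linarith
    then show "g = h \<and> j = k"
    proof cases
      case 1
      then show ?thesis using * inj_onD[OF p(1), of "(g, j)" "(h, k)"] by auto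
    next
      case 2
      then show ?thesis using * avoid[of g h k] by auto
    next
      case 3
      then show ?thesis using * avoid[of h g j] by auto
    next
      case 4
      then show ?thesis using * x(3) by (auto simp: inj_on_def)
    qed
  qed
  moreover have "(\<Sum>i\<in>I. (\<Sum>j<Suc n. f i (?q j))\<^sup>2) \<le> real (Suc n) * (2 + real (card I) * B\<^sup>2)"
  proof -
    have "(\<Sum>j<Suc n. f i (?q j)) = s i + f i x" for i by (simp add: s_def)
    then have "(\<Sum>i\<in>I. (\<Sum>j<Suc n. f i (?q j))\<^sup>2) = (\<Sum>i\<in>I. (s i)\<^sup>2 + 2 * (s i * f i x) + (f i x)\<^sup>2)"
      by (simp add: power2_sum algebra_simps)
    also have "\<dots> = (\<Sum>i\<in>I. (s i)\<^sup>2) + 2 * \<phi> x + (\<Sum>i\<in>I. (f i x)\<^sup>2)"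
      by (simp add: sum.distrib \<phi>_def sum_distrib_left)
    also have "(\<Sum>i\<in>I. (f i x)\<^sup>2) \<le> real (card I) * B\<^sup>2"
    proof (rule sum_bounded_above)
      fix i assume "i \<in> I"
      then show "(f i x)\<^sup>2 \<le> B\<^sup>2" using power_mono[OF B abs_ge_zero, of i x 2] by simp
    qed
    finally show ?thesis using p(2) x(1) by (simp add: s_def algebra_simps)
  qed
  ultimately show ?case by blast
qed

end

section \<open>Growth of uniform complexity\<close>

context uniform_action
begin

text \<open>The condition on the supremum, freed of extended reals.\<close>

definition slow_growth :: bool where
  "slow_growth \<longleftrightarrow> (\<forall>E \<U> e. finite E \<longrightarrow> E \<subseteq> G \<longrightarrow> \<U> \<in> finite_uniform_coverings D \<longrightarrow> e > 0 \<longrightarrow>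
    (\<exists>\<X>\<in>finite_uniform_coverings D. \<U> \<preceq> \<X> \<and>
      real (uniform_complexity D (cover_join E (\<lambda>g. image_family g \<X>)))
        \<le> (1 + e) * real (uniform_complexity D \<X>)))"

text \<open>The supremum is never less than one, as \<open>E = {id}\<close> and the trivial covering show. Hence it equals
  one if and only if every infimum is at most one.\<close>

lemma slow_growth_iff:
  "slow_growth \<longleftrightarrow>
    (SUP E\<in>{E. finite E \<and> E \<subseteq> G}. SUP \<U>\<in>finite_uniform_coverings D.
       INF \<X>\<in>{\<X> \<in> finite_uniform_coverings D. \<U> \<preceq> \<X>}.
         ereal (real (uniform_complexity D (cover_join E (\<lambda>g. image_family g \<X>)))
                / real (uniform_complexity D \<X>))) = 1"
  (is "_ \<longleftrightarrow> ?S = 1")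
proof -
  let ?N = "\<lambda>\<U>. real (uniform_complexity D \<U>)"
  let ?J = "\<lambda>E \<X>. cover_join E (\<lambda>g. image_family g \<X>)"
  let ?I = "\<lambda>E \<U>. INF \<X>\<in>{\<X> \<in> finite_uniform_coverings D. \<U> \<preceq> \<X>}. ereal (?N (?J E \<X>) / ?N \<X>)"
  have pos: "?N \<X> > 0" if "\<X> \<in> finite_uniform_coverings D" for \<X>
    using uniform_complexity_pos[OF that] by simp
  have upper: "?I E \<U> \<le> ?S" if "finite E" "E \<subseteq> G" "\<U> \<in> finite_uniform_coverings D" for E \<U>
    using that by (intro SUP_upper2[of E] SUP_upper2[of \<U>]) auto
  have "1 \<le> ?S"
  proof -
    have "1 \<le> ?I {id} {UNIV}"
    proof (rule INF_greatest)
      fix \<X> assume "\<X> \<in> {\<X> \<in> finite_uniform_coverings D. {UNIV} \<preceq> \<X>}"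
      then have X: "\<X> \<in> finite_uniform_coverings D" by simp
      have "\<X> \<preceq> ?J {id} \<X>"
        using cover_join_upper[of id "{id}" "\<lambda>g. image_family g \<X>"] by (simp add: image_family_def)
      moreover have "?J {id} \<X> \<in> finite_uniform_coverings D"
        using X action_id by (intro cover_join_image_finite_uniform) auto
      ultimately have "?N \<X> \<le> ?N (?J {id} \<X>)" using uniform_complexity_mono by simp
      then show "1 \<le> ereal (?N (?J {id} \<X>) / ?N \<X>)"
        using pos[OF X] by (simp add: pos_le_divide_eq one_ereal_def del: ereal_eq_1)
    qed
    also have "\<dots> \<le> ?S"
      using action_id trivial_covering by (intro upper) (auto simp: finite_uniform_coverings_def)
    finally show ?thesis .
  qed
  moreover have "?S \<le> 1" if slow: slow_growth
  proof (intro SUP_least)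
    fix E \<U> assume E: "E \<in> {E. finite E \<and> E \<subseteq> G}" and U: "\<U> \<in> finite_uniform_coverings D"
    show "?I E \<U> \<le> 1"
    proof (rule ereal_le_epsilon2)
      fix e :: real assume "0 < e"
      then obtain \<X> where X: "\<X> \<in> finite_uniform_coverings D" "\<U> \<preceq> \<X>"
        "?N (?J E \<X>) \<le> (1 + e) * ?N \<X>"
        using slow E U unfolding slow_growth_def by blast
      then have "?N (?J E \<X>) / ?N \<X> \<le> 1 + e" using pos by (simp add: pos_divide_le_eq)
      then have "ereal (?N (?J E \<X>) / ?N \<X>) \<le> 1 + ereal e"
        by (simp add: one_ereal_def del: ereal_eq_1)
      then show "?I E \<U> \<le> 1 + ereal e" using X(1,2) by (intro INF_lower2[of \<X>]) auto
    qed
  qed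
  moreover have slow_growth if "?S = 1"
    unfolding slow_growth_def
  proof (intro allI impI)
    fix E \<U> and e :: real
    assume "finite E" "E \<subseteq> G" "\<U> \<in> finite_uniform_coverings D" "e > 0"
    then have "?I E \<U> < ereal (1 + e)"
      using upper[of E \<U>] \<open>?S = 1\<close> by (auto simp: one_ereal_def simp del: ereal_eq_1 intro: le_less_trans)
    then obtain \<X> where X: "\<X> \<in> finite_uniform_coverings D" "\<U> \<preceq> \<X>" "?N (?J E \<X>) / ?N \<X> < 1 + e"
      by (auto simp: INF_less_iff)
    then have "?N (?J E \<X>) \<le> (1 + e) * ?N \<X>" using pos[OF X(1)] by (simp add: pos_divide_less_eq)
    then show "\<exists>\<X>\<in>finite_uniform_coverings D. \<U> \<preceq> \<X> \<and> ?N (?J E \<X>) \<le> (1 + e) * ?N \<X>"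
      using X(1,2) by (intro bexI[of _ \<X>] conjI)
  qed
  ultimately show ?thesis by (meson antisym)
qed

end

section \<open>Slow growth of complexity from an invariant mean\<close>

context free_perfect_action
begin

text \<open>Read \<open>j\<close> as a labelling of the points by finitely many labels. The vertex \<open>i\<close> is joined to \<open>k\<close> if
  \<open>g (p k)\<close> is near the set of points with the label of \<open>p i\<close>. Given a vertex cover, let \<open>J\<close> be the
  labels of the uncovered \<open>p i\<close> and \<open>h J\<close> a Urysohn function that is one on the points with labels in
  \<open>J\<close>. Then \<open>h J\<close> is one at every uncovered \<open>p i\<close> and vanishes at every uncovered \<open>g (p k)\<close>. As
  \<open>h J \<circ> g\<close> and \<open>h J\<close> have almost the same sum over the points, the vertex cover is almost as large as the
  set of points. There are finitely many functions \<open>h J\<close>, so one choice of points serves all of them.\<close>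

lemma almost_perfect_matchings:
  assumes m: "is_mean D m" and inv: "\<And>f g. f \<in> UC_b D \<Longrightarrow> g \<in> G \<Longrightarrow> m (f \<circ> g) = m f"
    and E: "finite E" "E \<subseteq> G" and V: "\<V> \<in> D" and j: "finite (range j)"
  shows "\<exists>L. \<forall>q. \<exists>p. inj_on (\<lambda>(g, i). g (p i)) (E \<times> {..<q\<^sup>2}) \<and>
    (\<forall>g\<in>E. \<exists>M\<subseteq>{..<q\<^sup>2} \<times> {..<q\<^sup>2}. inj_on fst M \<and> inj_on snd M \<and> q\<^sup>2 - L * q \<le> card M \<and>
      (\<forall>(i, k)\<in>M. \<exists>x. j x = j (p i) \<and> near \<V> x (g (p k))))"
proof -
  have "\<forall>J. \<exists>h. h \<in> UC_b D \<and> (\<forall>x. 0 \<le> h x \<and> h x \<le> 1) \<and> (\<forall>x\<in>{x. j x \<in> J}. h x = 1) \<and>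
    (\<forall>x. h x \<noteq> 0 \<longrightarrow> (\<exists>a\<in>{x. j x \<in> J}. near \<V> a x))"
    using uniform_urysohn[OF V] by blast
  then obtain h where h: "\<And>J. h J \<in> UC_b D" "\<And>J x. 0 \<le> h J x" "\<And>J x. h J x \<le> 1"
    "\<And>J x. j x \<in> J \<Longrightarrow> h J x = 1" "\<And>J x. h J x \<noteq> 0 \<Longrightarrow> \<exists>a. j a \<in> J \<and> near \<V> a x"
    by (metis mem_Collect_eq)
  define f where "f = (\<lambda>(g, J) x. (h J \<circ> g) x + (- 1) * h J x)"
  define I where "I = E \<times> Pow (range j)"
  define L where "L = 2 + card I"
  have "finite I" using E(1) j by (simp add: I_def)
  have "f i \<in> UC_b D" if "i \<in> I" for i
  proof -
    obtain g J where i: "i = (g, J)" "g \<in> G" using \<open>i \<in> I\<close> E(2) by (auto simp: I_def)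
    have "h J \<circ> g \<in> UC_b D" "(\<lambda>x. (- 1) * h J x) \<in> UC_b D"
      using i h(1) by (blast intro: UC_b_compose action_unif_continuous UC_b_scale)+
    from UC_b_add[OF this] show ?thesis by (simp add: f_def i(1))
  qed
  moreover have "m (f i) = 0" if "i \<in> I" for i
  proof -
    obtain g J where i: "i = (g, J)" "g \<in> G" using \<open>i \<in> I\<close> E(2) by (auto simp: I_def)
    have "h J \<circ> g \<in> UC_b D" "(\<lambda>x. (- 1) * h J x) \<in> UC_b D"
      using i h(1) by (blast intro: UC_b_compose action_unif_continuous UC_b_scale)+
    then have "m (\<lambda>x. (h J \<circ> g) x + (- 1) * h J x) = m (h J \<circ> g) + m (\<lambda>x. (- 1) * h J x)"
      by (rule mean_add[OF m])
    also have "m (\<lambda>x. (- 1) * h J x) = (- 1) * m (h J)"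
      by (rule mean_scale[OF m h(1)])
    finally show ?thesis using inv[OF h(1) i(2), of J] by (simp add: f_def i(1) comp_def)
  qed
  moreover have "\<bar>f i x\<bar> \<le> 1" for i x
    using h(2,3)[of "snd i" x] h(2,3)[of "snd i" "fst i x"]
    by (auto simp: f_def abs_le_iff split: prod.splits)
  ultimately have points: "\<exists>p. inj_on (\<lambda>(g, i). g (p i)) (E \<times> {..<n}) \<and>
    (\<Sum>i\<in>I. (\<Sum>k<n. f i (p k))\<^sup>2) \<le> real n * (2 + real (card I) * 1\<^sup>2)" for n
    using generic_averaging_points[OF m \<open>finite I\<close>, of f 1 E n] E by blast
  have "\<exists>p. inj_on (\<lambda>(g, i). g (p i)) (E \<times> {..<q\<^sup>2}) \<and>
    (\<forall>g\<in>E. \<exists>M\<subseteq>{..<q\<^sup>2} \<times> {..<q\<^sup>2}. inj_on fst M \<and> inj_on snd M \<and> q\<^sup>2 - L * q \<le> card M \<and>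
      (\<forall>(i, k)\<in>M. \<exists>x. j x = j (p i) \<and> near \<V> x (g (p k))))" for q
  proof -
    obtain p where p: "inj_on (\<lambda>(g, i). g (p i)) (E \<times> {..<q\<^sup>2})"
      and sq: "(\<Sum>i\<in>I. (\<Sum>k<q\<^sup>2. f i (p k))\<^sup>2) \<le> real (q\<^sup>2) * (2 + real (card I) * 1\<^sup>2)"
      using points[of "q\<^sup>2"] by blast
    have small: "\<bar>\<Sum>k<q\<^sup>2. f i (p k)\<bar> \<le> real (L * q)" if "i \<in> I" for i
    proof -
      have "(\<Sum>k<q\<^sup>2. f i (p k))\<^sup>2 \<le> (\<Sum>i\<in>I. (\<Sum>k<q\<^sup>2. f i (p k))\<^sup>2)"
        using that \<open>finite I\<close> by (intro member_le_sum) auto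
      also have "\<dots> \<le> real (q\<^sup>2 * L)" using sq by (simp add: L_def algebra_simps)
      also have "q\<^sup>2 * L \<le> (L * q)\<^sup>2" by (simp add: power_mult_distrib power2_eq_square)
      finally show ?thesis using abs_le_square_iff[of "\<Sum>k<q\<^sup>2. f i (p k)" "real (L * q)"] by simp
    qed
    have "\<exists>M\<subseteq>{..<q\<^sup>2} \<times> {..<q\<^sup>2}. inj_on fst M \<and> inj_on snd M \<and> q\<^sup>2 - L * q \<le> card M \<and>
      (\<forall>(i, k)\<in>M. \<exists>x. j x = j (p i) \<and> near \<V> x (g (p k)))" if g: "g \<in> E" for g
    proof -
      define R where "R = {(i, k) \<in> {..<q\<^sup>2} \<times> {..<q\<^sup>2}. \<exists>x. j x = j (p i) \<and> near \<V> x (g (p k))}"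
      have "finite R" by (rule finite_subset[of _ "{..<q\<^sup>2} \<times> {..<q\<^sup>2}"]) (auto simp: R_def)
      moreover have "q\<^sup>2 - L * q \<le> card S + card T" if ST: "vertex_cover R S T" for S T
      proof -
        note fin = ST[unfolded vertex_cover_def]
        define J where "J = j ` p ` ({..<q\<^sup>2} - S)"
        have "(g, J) \<in> I" using g by (auto simp: I_def J_def)
        \<comment> \<open>Count the uncovered \<open>p i\<close> by \<open>h J\<close>, apply \<open>g\<close>, and count the covered \<open>g (p k)\<close>.\<close>
        have "real (q\<^sup>2) - real (card S) \<le> real (card ({..<q\<^sup>2} - S))"
        proof -
          have "q\<^sup>2 \<le> card ({..<q\<^sup>2} - S) + card S"
            using diff_card_le_card_Diff[of S "{..<q\<^sup>2}"] fin by simp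
          then have "real (q\<^sup>2) \<le> real (card ({..<q\<^sup>2} - S) + card S)" by (simp only: of_nat_le_iff)
          then show ?thesis by simp
        qed
        also have "\<dots> = (\<Sum>i\<in>{..<q\<^sup>2} - S. h J (p i))"
          using h(4)[of _ J] by (simp add: J_def)
        also have "\<dots> \<le> (\<Sum>i<q\<^sup>2. h J (p i))"
          using h(2) by (intro sum_mono2) auto
        also have "\<dots> = (\<Sum>k<q\<^sup>2. h J (g (p k))) - (\<Sum>k<q\<^sup>2. f (g, J) (p k))"
          by (simp add: f_def sum_subtractf)
        also have "\<dots> \<le> (\<Sum>k<q\<^sup>2. h J (g (p k))) + real (L * q)"
          using small[OF \<open>(g, J) \<in> I\<close>] by linarith
        also have "(\<Sum>k<q\<^sup>2. h J (g (p k))) = (\<Sum>k\<in>{..<q\<^sup>2} \<inter> T. h J (g (p k)))"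
        proof (rule sum.mono_neutral_right)
          show "\<forall>k\<in>{..<q\<^sup>2} - {..<q\<^sup>2} \<inter> T. h J (g (p k)) = 0"
          proof (rule ballI, rule ccontr)
            fix k assume k: "k \<in> {..<q\<^sup>2} - {..<q\<^sup>2} \<inter> T" and "h J (g (p k)) \<noteq> 0"
            then obtain a i where "j a = j (p i)" "i < q\<^sup>2" "i \<notin> S" "near \<V> a (g (p k))"
              using h(5) unfolding J_def by blast
            then have "(i, k) \<in> R" using k by (auto simp: R_def)
            then show False using fin k \<open>i \<notin> S\<close> by auto
          qed
        qed auto
        also have "\<dots> \<le> real (card ({..<q\<^sup>2} \<inter> T))"
          using sum_bounded_above[of "{..<q\<^sup>2} \<inter> T" "\<lambda>k. h J (g (p k))" 1] h(3) by simp
        also have "\<dots> \<le> real (card T)" using fin by (simp add: card_mono)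
        finally have "real (q\<^sup>2) \<le> real (card S + card T + L * q)" by simp
        then show ?thesis by (simp only: of_nat_le_iff)
      qed
      ultimately obtain M where "M \<subseteq> R" "inj_on fst M" "inj_on snd M" "q\<^sup>2 - L * q \<le> card M"
        using koenig by blast
      then show ?thesis by (intro exI[of _ M]) (auto simp: R_def)
    qed
    then show ?thesis using p by blast
  qed
  then show ?thesis by blast
qed

text \<open>Finite sets are closed in a Hausdorff space, so a finite set is discrete, and one uniform covering
  witnesses this for all of its points.\<close>

lemma separating_uniform_covering:
  assumes "finite Z"
  shows "\<exists>\<U>\<in>D. \<forall>z\<in>Z. \<forall>w\<in>Z. near \<U> z w \<longrightarrow> z = w"
proof -
  have "\<forall>z\<in>Z. \<exists>\<U>\<in>D. \<forall>w\<in>Z. near \<U> z w \<longrightarrow> z = w"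
  proof
    fix z assume "z \<in> Z"
    have "openin (uniform_topology D) (topspace (uniform_topology D) - (Z - {z}))"
      using assms by (intro openin_diff_finite) auto
    then have "openin (uniform_topology D) (- (Z - {z}))"
      by (simp add: topspace_uniform_topology[OF uniformity] Compl_eq_Diff_UNIV)
    then obtain \<U> where "\<U> \<in> D" "\<forall>w. near \<U> z w \<longrightarrow> w \<in> - (Z - {z})"
      unfolding openin_iff by auto
    then show "\<exists>\<U>\<in>D. \<forall>w\<in>Z. near \<U> z w \<longrightarrow> z = w" by (intro bexI[of _ \<U>]) auto
  qed
  then obtain \<U> where U: "\<And>z. z \<in> Z \<Longrightarrow> \<U> z \<in> D" "\<And>z w. z \<in> Z \<Longrightarrow> w \<in> Z \<Longrightarrow> near (\<U> z) z w \<Longrightarrow> z = w"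
    by metis
  obtain \<W> where W: "\<W> \<in> D" "\<And>z. z \<in> Z \<Longrightarrow> \<U> z \<preceq> \<W>"
    using common_refinement[of Z \<U>] assms U(1) by blast
  have "z = w" if "z \<in> Z" "w \<in> Z" "near \<W> z w" for z w
    using U(2)[OF that(1,2) near_refined[OF W(2)[OF that(1)] that(3)]] .
  then show ?thesis using W(1) by blast
qed

text \<open>The special member \<open>W i\<close> is the set that labels \<open>p i\<close>, deprived of all orbit points
  \<open>g (p k)\<close> except those matched with \<open>i\<close>; the members of \<open>\<U>\<^sub>0\<close> deprived of all orbit points cover
  the rest. Since the \<open>g (p k)\<close> are distinct, \<open>g (p k)\<close> stays in \<open>W i\<close> only if \<open>M g\<close> itself matches \<open>i\<close>
  with \<open>k\<close>, and for each \<open>g\<close> there is at most one such \<open>k\<close>. So no set \<open>g -` W i\<close> contains two of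
  the points \<open>p k\<close> with \<open>k\<close> in \<open>F\<close>, which is the lower bound for the complexity of \<open>\<X> = {g -` A | g A. g \<in> E \<and> A \<in> \<W>}\<close>,
  where \<open>\<W>\<close> is the covering so described. The upper bound holds because \<open>\<W>\<close> refines \<open>g \<X>\<close> for
  every \<open>g\<close> in \<open>E\<close>.\<close>

lemma covering_from_matchings:
  fixes n :: nat
  assumes E: "finite E" "E \<subseteq> G" "E \<noteq> {}" and U: "\<U> \<in> finite_uniform_coverings D"
    and U0: "\<U>\<^sub>0 = cover_join E (\<lambda>g. image_family g \<U>)"
    and V: "\<V> \<in> D" and j: "\<And>x. j x \<in> \<U>\<^sub>0" "\<And>x y z. near \<V> x y \<Longrightarrow> near \<V> y z \<Longrightarrow> z \<in> j x"
    and p: "inj_on (\<lambda>(g, i). g (p i)) (E \<times> {..<n})"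
    and M: "\<And>g. g \<in> E \<Longrightarrow> M g \<subseteq> {..<n} \<times> {..<n}" "\<And>g. g \<in> E \<Longrightarrow> inj_on fst (M g)"
    and near: "\<And>g i k. g \<in> E \<Longrightarrow> (i, k) \<in> M g \<Longrightarrow> \<exists>x. j x = j (p i) \<and> near \<V> x (g (p k))"
    and F: "\<And>g k. g \<in> E \<Longrightarrow> k \<in> F \<Longrightarrow> \<exists>i. (i, k) \<in> M g"
  shows "\<exists>\<X>\<in>finite_uniform_coverings D. \<U> \<preceq> \<X> \<and> card F \<le> uniform_complexity D \<X> \<and>
    uniform_complexity D (cover_join E (\<lambda>g. image_family g \<X>)) \<le> n + card \<U>\<^sub>0"
proof -
  have U0_fin: "\<U>\<^sub>0 \<in> D" "finite \<U>\<^sub>0"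
    using cover_join_image_finite_uniform[OF E(1,2) U] by (auto simp: U0 finite_uniform_coverings_def)
  have F_sub: "F \<subseteq> {..<n}" using F M(1) E(3) by blast
  then have "finite F" by (rule finite_subset) simp
  \<comment> \<open>The orbit points that may stay in the special member \<open>W i\<close>.\<close>
  define Z where "Z i = {g (p k) | g k. g \<in> E \<and> k \<in> F \<and> (i, k) \<in> M g}" for i
  define Z_all where "Z_all = (\<lambda>(g, k). g (p k)) ` (E \<times> F)"
  have "finite Z_all" using E(1) \<open>finite F\<close> by (simp add: Z_all_def)
  define W where "W i = j (p i) - (Z_all - Z i)" for i
  define \<W> where "\<W> = W ` {..<n} \<union> (\<lambda>U. U - Z_all) ` \<U>\<^sub>0"
  have Z_unique: "(i, k) \<in> M g" if gk: "g \<in> E" "k \<in> F" "g (p k) \<in> Z i" for g i k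
  proof -
    obtain g' k' where *: "g' \<in> E" "k' \<in> F" "(i, k') \<in> M g'" "g (p k) = g' (p k')"
      using gk(3) by (auto simp: Z_def)
    then have "(g, k) = (g', k')" using inj_onD[OF p, of "(g, k)" "(g', k')"] gk F_sub by auto
    then show ?thesis using *(3) by simp
  qed
  have star: "w \<in> j (p i)" if "z \<in> Z i" "near \<V> z w" for z w i
  proof -
    obtain g k where "g \<in> E" "(i, k) \<in> M g" "z = g (p k)" using \<open>z \<in> Z i\<close> by (auto simp: Z_def)
    then obtain x where "j x = j (p i)" "near \<V> x z" using near by blast
    then show ?thesis using j(2) \<open>near \<V> z w\<close> by metis
  qed
  have "\<W> \<in> D"
  proof -
    obtain \<S> where S: "\<S> \<in> D" "\<forall>z\<in>Z_all. \<forall>w\<in>Z_all. near \<S> z w \<longrightarrow> z = w"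
      using separating_uniform_covering[OF \<open>finite Z_all\<close>] by blast
    obtain \<Y>' where Y': "\<Y>' \<in> D" "\<S> \<preceq> \<Y>'" "\<V> \<preceq> \<Y>'"
      using star_refinement[OF S(1) V] star_refined_by_imp_refined_by by metis
    obtain \<Y> where Y: "\<Y> \<in> D" "\<U>\<^sub>0 \<preceq> \<Y>" "\<Y>' \<preceq> \<Y>"
      using star_refinement[OF U0_fin(1) Y'(1)] star_refined_by_imp_refined_by by metis
    have "\<W> \<preceq> \<Y>"
      unfolding refined_by_def
    proof
      fix Y assume "Y \<in> \<Y>"
      show "\<exists>A\<in>\<W>. Y \<subseteq> A"
      \<comment> \<open>A member of \<open>\<Y>\<close> with an orbit point has no other one, and fits into a special member that keeps this point.\<close>
      proof (cases "Y \<inter> Z_all = {}")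
        case True
        obtain U where "U \<in> \<U>\<^sub>0" "Y \<subseteq> U" using Y(2) \<open>Y \<in> \<Y>\<close> by (auto simp: refined_by_def)
        then have "Y \<subseteq> U - Z_all" "U - Z_all \<in> \<W>" using True by (auto simp: \<W>_def)
        then show ?thesis by blast
      next
        case False
        then obtain g k where z: "g \<in> E" "k \<in> F" "g (p k) \<in> Y" by (auto simp: Z_all_def)
        obtain i where i: "(i, k) \<in> M g" using F z by blast
        then have "i < n" using M(1) z(1) by blast
        have nearY: "near \<Y>' (g (p k)) w" if "w \<in> Y" for w
          using near_refined[OF Y(3)] nearI[OF \<open>Y \<in> \<Y>\<close> z(3) that] by blast
        have "g (p k) \<in> Z i" using z i by (auto simp: Z_def)
        have "w \<in> W i" if "w \<in> Y" for w
        proof -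
          have "w \<in> j (p i)"
            using star[OF \<open>g (p k) \<in> Z i\<close>] near_refined[OF Y'(3) nearY[OF that]] by blast
          moreover have "w = g (p k)" if "w \<in> Z_all"
          proof -
            have "g (p k) \<in> Z_all" using z by (auto simp: Z_all_def)
            then show ?thesis using S(2) near_refined[OF Y'(2) nearY[OF \<open>w \<in> Y\<close>]] that by metis
          qed
          ultimately show ?thesis using \<open>g (p k) \<in> Z i\<close> by (auto simp: W_def)
        qed
        then show ?thesis using \<open>i < n\<close> by (auto simp: \<W>_def)
      qed
    qed
    then show ?thesis using refined_uniform Y(1) by blast
  qed
  have "finite \<W>" using U0_fin(2) by (simp add: \<W>_def)
  have card_W: "card \<W> \<le> n + card \<U>\<^sub>0"
    unfolding \<W>_def
    by (rule order_trans[OF card_Un_le])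
      (intro add_mono order_trans[OF card_image_le]; simp add: U0_fin(2))
  define \<X> where "\<X> = (\<lambda>(g, A). g -` A) ` (E \<times> \<W>)"
  have XI: "g -` A \<in> \<X>" if "g \<in> E" "A \<in> \<W>" for g A using that by (auto simp: \<X>_def)
  have "\<X> \<in> D"
  proof -
    obtain g where "g \<in> E" using E(3) by blast
    then have "{g -` A | A. A \<in> \<W>} \<in> D" using vimage_family_uniform E(2) \<open>\<W> \<in> D\<close> by blast
    moreover have "\<X> \<preceq> {g -` A | A. A \<in> \<W>}"
      using XI[OF \<open>g \<in> E\<close>] by (auto simp: refined_by_def)
    ultimately show ?thesis using refined_uniform by blast
  qed
  then have X: "\<X> \<in> finite_uniform_coverings D"
    using \<open>finite \<W>\<close> E(1) by (simp add: finite_uniform_coverings_def \<X>_def)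
  have "\<U> \<preceq> \<X>"
    unfolding refined_by_def
  proof
    fix B assume "B \<in> \<X>"
    then obtain g A where B: "g \<in> E" "A \<in> \<W>" "B = g -` A" by (auto simp: \<X>_def)
    then obtain U' where "U' \<in> \<U>\<^sub>0" "A \<subseteq> U'" using j(1) by (auto simp: \<W>_def W_def)
    moreover have "image_family g \<U> \<preceq> \<U>\<^sub>0"
      unfolding U0 using cover_join_upper[OF B(1), of "\<lambda>g. image_family g \<U>"] by simp
    ultimately obtain U'' where "U'' \<in> image_family g \<U>" "A \<subseteq> U''"
      unfolding refined_by_def by (meson order_trans)
    then obtain U where U: "U \<in> \<U>" "A \<subseteq> g ` U" by (auto simp: image_family_def)
    have "g \<in> G" using B(1) E(2) by blast
    have "B \<subseteq> U"
    proof
      fix x assume "x \<in> B"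
      then have "g x \<in> g ` U" using B(3) U(2) by auto
      then show "x \<in> U" using action_eq_iff[OF \<open>g \<in> G\<close>] by auto
    qed
    then show "\<exists>U\<in>\<U>. B \<subseteq> U" using U(1) by blast
  qed
  moreover have "card F \<le> uniform_complexity D \<X>"
  proof -
    obtain \<C> where C: "\<C> \<in> finite_uniform_coverings D" "\<X> \<preceq> \<C>" "card \<C> = uniform_complexity D \<X>"
      using uniform_complexity_attained[OF X] .
    have "\<C> \<in> D" using C(1) by (simp add: finite_uniform_coverings_def)
    then have "\<forall>k. \<exists>c. c \<in> \<C> \<and> p k \<in> c" by (meson coveredE)
    then obtain c where c: "\<And>k. c k \<in> \<C>" "\<And>k. p k \<in> c k" by metis
    have "inj_on c F"
    proof (rule inj_onI)
      fix k k' assume k: "k \<in> F" "k' \<in> F" "c k = c k'"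
      obtain B where "B \<in> \<X>" "c k \<subseteq> B" using C(2) c(1)[of k] unfolding refined_by_def by meson
      then obtain g A where g: "g \<in> E" "A \<in> \<W>" "c k \<subseteq> g -` A" by (auto simp: \<X>_def)
      then have A: "g (p k) \<in> A" "g (p k') \<in> A" using c(2) k(3) by auto
      have "g (p k) \<in> Z_all" "g (p k') \<in> Z_all" using g(1) k by (auto simp: Z_all_def)
      then obtain i where "g (p k) \<in> Z i" "g (p k') \<in> Z i"
        using A g(2) by (auto simp: \<W>_def W_def)
      then have "(i, k) \<in> M g" "(i, k') \<in> M g" using Z_unique g(1) k by blast+
      then show "k = k'" using inj_onD[OF M(2)[OF g(1)]] by fastforce
    qed
    then have "card F \<le> card \<C>"
      using c(1) C(1) by (intro card_inj_on_le) (auto simp: finite_uniform_coverings_def)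
    then show ?thesis using C(3) by simp
  qed
  moreover have "uniform_complexity D (cover_join E (\<lambda>g. image_family g \<X>)) \<le> n + card \<U>\<^sub>0"
  proof -
    have "cover_join E (\<lambda>g. image_family g \<X>) \<preceq> \<W>"
    proof (rule cover_join_least)
      fix g assume g: "g \<in> E"
      have "A \<in> image_family g \<X>" if "A \<in> \<W>" for A
      proof -
        have "g ` (g -` A) = A" using action_bij g E(2) by (meson bij_is_surj subsetD surj_image_vimage_eq)
        then show ?thesis unfolding image_family_def using XI[OF g that] by blast
      qed
      then show "image_family g \<X> \<preceq> \<W>" by (auto simp: refined_by_def)
    qed
    then show ?thesis
      using uniform_complexity_le[of \<W>] \<open>\<W> \<in> D\<close> \<open>finite \<W>\<close> card_W
      by (force simp: finite_uniform_coverings_def)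
  qed
  ultimately show ?thesis using X by blast
qed

text \<open>With \<open>n = q\<^sup>2\<close> points the matchings miss at most \<open>L * q\<close> indices for each \<open>g\<close>, so
  \<open>covering_from_matchings\<close> compares \<open>q\<^sup>2 + u\<close> with \<open>q\<^sup>2 - a * q\<close> for constants \<open>u\<close> and \<open>a\<close>. The square
  numbers keep square roots out of the estimates.\<close>

lemma slow_growth_if_amenable:
  assumes amen: "amenable D G" and E: "finite E" "E \<subseteq> G" "E \<noteq> {}"
    and U: "\<U> \<in> finite_uniform_coverings D" and e: "e > 0"
  shows "\<exists>\<X>\<in>finite_uniform_coverings D. \<U> \<preceq> \<X> \<and>
    real (uniform_complexity D (cover_join E (\<lambda>g. image_family g \<X>)))
      \<le> (1 + e) * real (uniform_complexity D \<X>)"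
proof -
  obtain m where m: "is_mean D m" "\<And>f g. f \<in> UC_b D \<Longrightarrow> g \<in> G \<Longrightarrow> m (f \<circ> g) = m f"
    using amen by (auto simp: amenable_def)
  define \<U>\<^sub>0 where "\<U>\<^sub>0 = cover_join E (\<lambda>g. image_family g \<U>)"
  have U0: "\<U>\<^sub>0 \<in> D" "finite \<U>\<^sub>0"
    using cover_join_image_finite_uniform[OF E(1,2) U] by (auto simp: \<U>\<^sub>0_def finite_uniform_coverings_def)
  obtain \<V> where V: "\<V> \<in> D" "\<forall>x. \<exists>A\<in>\<U>\<^sub>0. \<forall>y z. near \<V> x y \<longrightarrow> near \<V> y z \<longrightarrow> z \<in> A"
    using two_step_refinement[OF U0(1)] by blast
  then obtain j where j: "\<And>x. j x \<in> \<U>\<^sub>0" "\<And>x y z. near \<V> x y \<Longrightarrow> near \<V> y z \<Longrightarrow> z \<in> j x"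
    by metis
  have "finite (range j)" using U0(2) j(1) by (meson finite_subset image_subsetI)
  then obtain L where L: "\<And>q. \<exists>p. inj_on (\<lambda>(g, i). g (p i)) (E \<times> {..<q\<^sup>2}) \<and>
    (\<forall>g\<in>E. \<exists>M\<subseteq>{..<q\<^sup>2} \<times> {..<q\<^sup>2}. inj_on fst M \<and> inj_on snd M \<and> q\<^sup>2 - L * q \<le> card M \<and>
      (\<forall>(i, k)\<in>M. \<exists>x. j x = j (p i) \<and> near \<V> x (g (p k))))"
    using almost_perfect_matchings[OF m E(1,2) V(1), of j] by blast
  define a where "a = real (card E * L)"
  define u where "u = real (card \<U>\<^sub>0)"
  \<comment> \<open>Multiplied by \<open>q\<close>, this is the inequality between \<open>q\<^sup>2 + u * q\<close> and \<open>(1 + e) * (q\<^sup>2 - a * q)\<close>.\<close>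
  have "\<exists>q::nat. q > 0 \<and> (1 + e) * a + u \<le> e * real q"
  proof -
    obtain q :: nat where "((1 + e) * a + u) / e \<le> real q" using real_arch_simple by blast
    then have "(1 + e) * a + u \<le> e * real q" using e by (simp add: divide_le_eq mult.commute)
    also have "\<dots> \<le> e * real (Suc q)" using e by simp
    finally show ?thesis by blast
  qed
  then obtain q :: nat where q: "q > 0" "(1 + e) * a + u \<le> e * real q" by blast
  obtain p where p: "inj_on (\<lambda>(g, i). g (p i)) (E \<times> {..<q\<^sup>2})"
    and "\<forall>g\<in>E. \<exists>M\<subseteq>{..<q\<^sup>2} \<times> {..<q\<^sup>2}. inj_on fst M \<and> inj_on snd M \<and> q\<^sup>2 - L * q \<le> card M \<and>
      (\<forall>(i, k)\<in>M. \<exists>x. j x = j (p i) \<and> near \<V> x (g (p k)))"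
    using L[of q] by blast
  then have "\<forall>g\<in>E. \<exists>M. M \<subseteq> {..<q\<^sup>2} \<times> {..<q\<^sup>2} \<and> inj_on fst M \<and> inj_on snd M \<and> q\<^sup>2 - L * q \<le> card M \<and>
      (\<forall>i k. (i, k) \<in> M \<longrightarrow> (\<exists>x. j x = j (p i) \<and> near \<V> x (g (p k))))" by fast
  from bchoice[OF this] obtain M where M0: "\<forall>g\<in>E. M g \<subseteq> {..<q\<^sup>2} \<times> {..<q\<^sup>2} \<and> inj_on fst (M g) \<and>
      inj_on snd (M g) \<and> q\<^sup>2 - L * q \<le> card (M g) \<and>
      (\<forall>i k. (i, k) \<in> M g \<longrightarrow> (\<exists>x. j x = j (p i) \<and> near \<V> x (g (p k))))" ..
  have M: "M g \<subseteq> {..<q\<^sup>2} \<times> {..<q\<^sup>2}" "inj_on fst (M g)" "inj_on snd (M g)" "q\<^sup>2 - L * q \<le> card (M g)"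
    "\<And>i k. (i, k) \<in> M g \<Longrightarrow> \<exists>x. j x = j (p i) \<and> near \<V> x (g (p k))" if "g \<in> E" for g
    using bspec[OF M0 that] by blast+
  define F where "F = {..<q\<^sup>2} - (\<Union>g\<in>E. {..<q\<^sup>2} - snd ` M g)"
  have cov: "\<exists>i. (i, k) \<in> M g" if "g \<in> E" "k \<in> F" for g k
  proof -
    have "k \<in> snd ` M g" using that unfolding F_def by blast
    then show ?thesis by auto
  qed
  have "\<exists>\<X>\<in>finite_uniform_coverings D. \<U> \<preceq> \<X> \<and> card F \<le> uniform_complexity D \<X> \<and>
    uniform_complexity D (cover_join E (\<lambda>g. image_family g \<X>)) \<le> q\<^sup>2 + card \<U>\<^sub>0"
  proof (rule covering_from_matchings[where j = j and p = p and M = M, OF E U \<U>\<^sub>0_def V(1) j(1)])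
    show "z \<in> j x" if "near \<V> x y" "near \<V> y z" for x y z using that by (rule j(2))
  qed (rule p M cov; assumption)+
  then obtain \<X> where X: "\<X> \<in> finite_uniform_coverings D" "\<U> \<preceq> \<X>" "card F \<le> uniform_complexity D \<X>"
    "uniform_complexity D (cover_join E (\<lambda>g. image_family g \<X>)) \<le> q\<^sup>2 + card \<U>\<^sub>0" by blast
  have "card ({..<q\<^sup>2} - snd ` M g) \<le> L * q" if "g \<in> E" for g
  proof -
    have "snd ` M g \<subseteq> {..<q\<^sup>2}" using M(1)[OF that] by auto
    then have "card ({..<q\<^sup>2} - snd ` M g) = q\<^sup>2 - card (M g)"
      using card_image[OF M(3)[OF that]] by (simp add: card_Diff_subset finite_subset)
    then show ?thesis using M(4)[OF that] by linarith
  qed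
  then have "(\<Sum>g\<in>E. card ({..<q\<^sup>2} - snd ` M g)) \<le> card E * (L * q)"
    using sum_bounded_above[of E "\<lambda>g. card ({..<q\<^sup>2} - snd ` M g)" "L * q"] by simp
  moreover have "card (\<Union>g\<in>E. {..<q\<^sup>2} - snd ` M g) \<le> (\<Sum>g\<in>E. card ({..<q\<^sup>2} - snd ` M g))"
    using E(1) by (rule card_UN_le)
  moreover have "q\<^sup>2 - card (\<Union>g\<in>E. {..<q\<^sup>2} - snd ` M g) \<le> card F"
    using diff_card_le_card_Diff[of "\<Union>g\<in>E. {..<q\<^sup>2} - snd ` M g" "{..<q\<^sup>2}"] E(1) by (simp add: F_def)
  ultimately have "q\<^sup>2 \<le> card F + card E * L * q" by (simp add: mult.assoc)
  then have "real (q\<^sup>2) \<le> real (card F + card E * L * q)" by (simp only: of_nat_le_iff)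
  then have F: "(real q)\<^sup>2 - a * real q \<le> real (card F)" by (simp add: a_def)
  have "real (uniform_complexity D (cover_join E (\<lambda>g. image_family g \<X>))) \<le> (real q)\<^sup>2 + u"
    using X(4) by (simp add: u_def flip: of_nat_power of_nat_add)
  also have "\<dots> \<le> (real q)\<^sup>2 + u * real q"
    using mult_left_mono[of 1 "real q" u] q(1) by (simp add: u_def)
  also have "\<dots> \<le> (1 + e) * ((real q)\<^sup>2 - a * real q)"
    using mult_right_mono[OF q(2), of "real q"] by (simp add: algebra_simps power2_eq_square)
  also have "\<dots> \<le> (1 + e) * real (card F)" using F e by (intro mult_left_mono) auto
  also have "\<dots> \<le> (1 + e) * real (uniform_complexity D \<X>)"
    using X(3) e by (intro mult_left_mono) auto
  finally have "real (uniform_complexity D (cover_join E (\<lambda>g. image_family g \<X>)))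
      \<le> (1 + e) * real (uniform_complexity D \<X>)" .
  then show ?thesis by (intro bexI[OF _ X(1)] conjI X(2))
qed

end

section \<open>An invariant mean from slow growth of complexity\<close>

lemma matched_sums_close:
  fixes a :: "'c \<Rightarrow> real"
  assumes W: "finite W" and M: "M \<subseteq> W \<times> W" "inj_on fst M" "inj_on snd M"
    and close: "\<And>v w. (v, w) \<in> M \<Longrightarrow> \<bar>a v - b w\<bar> \<le> d"
    and B: "\<And>w. \<bar>a w\<bar> \<le> B" "\<And>w. \<bar>b w\<bar> \<le> B"
  shows "\<bar>(\<Sum>w\<in>W. a w) - (\<Sum>w\<in>W. b w)\<bar> \<le> real (card M) * d + 2 * B * (real (card W) - real (card M))"
proof -
  have sub: "fst ` M \<subseteq> W" "snd ` M \<subseteq> W" using M(1) by auto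
  have split: "(\<Sum>w\<in>W. c w) = (\<Sum>e\<in>M. c (\<pi> e)) + (\<Sum>w\<in>W - \<pi> ` M. c w)"
    "\<bar>\<Sum>w\<in>W - \<pi> ` M. c w\<bar> \<le> B * (real (card W) - real (card M))"
    if "\<pi> ` M \<subseteq> W" "inj_on \<pi> M" "\<And>w. \<bar>c w\<bar> \<le> B" for c :: "'c \<Rightarrow> real" and \<pi> :: "'c \<times> 'c \<Rightarrow> 'c"
  proof -
    show "(\<Sum>w\<in>W. c w) = (\<Sum>e\<in>M. c (\<pi> e)) + (\<Sum>w\<in>W - \<pi> ` M. c w)"
      using sum.subset_diff[OF that(1) W, of c] sum.reindex[OF that(2), of c] by simp
    have "card (W - \<pi> ` M) = card W - card M"
      using card_image[OF that(2)] that(1) W by (simp add: card_Diff_subset finite_subset)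
    moreover have "card M \<le> card W" using card_image[OF that(2)] card_mono[OF W that(1)] by simp
    moreover have "\<bar>\<Sum>w\<in>W - \<pi> ` M. c w\<bar> \<le> real (card (W - \<pi> ` M)) * B"
      using that(3) by (intro order_trans[OF sum_abs] sum_bounded_above)
    ultimately show "\<bar>\<Sum>w\<in>W - \<pi> ` M. c w\<bar> \<le> B * (real (card W) - real (card M))"
      by (simp add: of_nat_diff mult.commute)
  qed
  have "\<bar>(\<Sum>e\<in>M. a (fst e)) - (\<Sum>e\<in>M. b (snd e))\<bar> \<le> (\<Sum>e\<in>M. \<bar>a (fst e) - b (snd e)\<bar>)"
    by (simp add: sum_subtractf[symmetric] sum_abs)
  also have "\<dots> \<le> real (card M) * d" using close by (intro sum_bounded_above) auto
  finally show ?thesis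
    using split[where \<pi> = fst and c = a, OF sub(1) M(2) B(1)]
      split[where \<pi> = snd and c = b, OF sub(2) M(3) B(2)] by linarith
qed

context uniform_action
begin

text \<open>If \<open>A\<close> meets \<open>g ` B\<close>, a vertex cover contains \<open>A\<close> on the left or \<open>B\<close> on the right. So every non-empty
  member of a common refinement of \<open>\<W>\<close> and its translate by \<open>g\<close> lies in a set \<open>A\<close> from the left or in a
  translate \<open>g ` B\<close> of a set from the right. These sets form a uniform covering refining \<open>\<X>\<close>, and Koenig's
  theorem applies.\<close>

lemma large_matching_of_refinement:
  assumes g: "g \<in> G" and X: "\<X> \<in> finite_uniform_coverings D" and W: "\<W> \<in> finite_uniform_coverings D"
    and ref: "\<X> \<preceq> \<W>" "image_family (inv_into UNIV g) \<X> \<preceq> \<W>"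
  shows "\<exists>M\<subseteq>\<W> \<times> \<W>. inj_on fst M \<and> inj_on snd M \<and> uniform_complexity D \<X> \<le> card M \<and>
    (\<forall>(A, B)\<in>M. A \<inter> g ` B \<noteq> {})"
proof -
  have W': "\<W> \<in> D" "finite \<W>" using W by (auto simp: finite_uniform_coverings_def)
  define R where "R = {(A, B) \<in> \<W> \<times> \<W>. A \<inter> g ` B \<noteq> {}}"
  have "finite R" by (rule finite_subset[of _ "\<W> \<times> \<W>"]) (auto simp: R_def W')
  moreover have "uniform_complexity D \<X> \<le> card S + card T" if ST: "vertex_cover R S T" for S T
  proof -
    note ST = ST[unfolded vertex_cover_def]
    define \<C> where "\<C> = (S \<inter> \<W>) \<union> (`) g ` (T \<inter> \<W>)"
    obtain \<Y> where Y: "\<Y> \<in> D" "\<W> \<preceq> \<Y>" "image_family g \<W> \<preceq> \<Y>"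
      using star_refinement[OF W'(1) image_family_uniform[OF g W'(1)]]
        star_refined_by_imp_refined_by by metis
    have meet: "\<exists>C\<in>\<C>. Y \<subseteq> C" if Y': "Y \<in> \<Y>" "Y \<noteq> {}" for Y
    proof -
      obtain A where A: "A \<in> \<W>" "Y \<subseteq> A" using Y(2) Y'(1) unfolding refined_by_def by meson
      obtain B' where "B' \<in> image_family g \<W>" "Y \<subseteq> B'"
        using Y(3) Y'(1) unfolding refined_by_def by meson
      then obtain B where B: "B \<in> \<W>" "Y \<subseteq> g ` B" by (auto simp: image_family_def)
      have "(A, B) \<in> R" using A B Y'(2) by (auto simp: R_def)
      then have "A \<in> S \<or> B \<in> T" using ST by auto
      then show ?thesis using A B by (auto simp: \<C>_def)
    qed
    obtain Y where Y0: "Y \<in> \<Y>" "undefined \<in> Y" using coveredE[OF Y(1)] .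
    then have "\<C> \<noteq> {}" using meet by blast
    then have "\<C> \<preceq> \<Y>" unfolding refined_by_def using meet by blast
    then have "\<C> \<in> finite_uniform_coverings D"
      using refined_uniform[OF Y(1)] ST by (auto simp: finite_uniform_coverings_def \<C>_def)
    moreover have "\<X> \<preceq> \<C>"
      unfolding refined_by_def
    proof
      fix C assume "C \<in> \<C>"
      then consider "C \<in> \<W>" | B where "B \<in> \<W>" "C = g ` B" by (auto simp: \<C>_def)
      then show "\<exists>V\<in>\<X>. C \<subseteq> V"
      proof cases
        case 1
        then show ?thesis using ref(1) by (auto simp: refined_by_def)
      next
        case 2
        then obtain V' where "V' \<in> image_family (inv_into UNIV g) \<X>" "B \<subseteq> V'"
          using ref(2) unfolding refined_by_def by meson
        then obtain V where V: "V \<in> \<X>" "B \<subseteq> inv_into UNIV g ` V" by (auto simp: image_family_def)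
        have "C \<subseteq> V" using V(2) g by (auto simp: 2)
        then show ?thesis using V(1) by blast
      qed
    qed
    ultimately have "uniform_complexity D \<X> \<le> card \<C>" by (rule uniform_complexity_le)
    also have "\<dots> \<le> card (S \<inter> \<W>) + card ((`) g ` (T \<inter> \<W>))" unfolding \<C>_def by (rule card_Un_le)
    also have "card ((`) g ` (T \<inter> \<W>)) \<le> card (T \<inter> \<W>)" using ST by (intro card_image_le) auto
    also have "card (T \<inter> \<W>) \<le> card T" using ST by (intro card_mono) auto
    also have "card (S \<inter> \<W>) \<le> card S" using ST by (intro card_mono) auto
    finally show ?thesis by simp
  qed
  ultimately obtain M where "M \<subseteq> R" "inj_on fst M" "inj_on snd M" "uniform_complexity D \<X> \<le> card M"
    using koenig by blast
  then show ?thesis by (intro exI[of _ M]) (auto simp: R_def)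
qed

text \<open>The index set is an optimal refinement of the join and \<open>x\<close> picks a point in each of its members.
  A matched pair \<open>(A, B)\<close> contributes at most \<open>e / 2\<close>, because \<open>x A\<close> and \<open>g (x B)\<close> are both close to a
  common point of \<open>A\<close> and \<open>g ` B\<close>; the unmatched members form a proportion of at most \<open>d\<close>.\<close>

lemma almost_invariant_finite_average:
  assumes slow: "slow_growth" and F: "finite F" "F \<subseteq> UC_b D" and E: "finite E" "E \<subseteq> G" and e: "e > 0"
  shows "\<exists>(W :: 'a set set) x. finite W \<and> W \<noteq> {} \<and>
    (\<forall>f\<in>F. \<forall>g\<in>E. \<bar>(\<Sum>w\<in>W. f (x w)) - (\<Sum>w\<in>W. f (g (x w)))\<bar> \<le> e * real (card W))"
proof -
  have "\<forall>f\<in>F. \<exists>B. \<forall>x. \<bar>f x\<bar> \<le> B" using F(2) UC_b_iff by blast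
  then obtain b where b: "\<And>f x. f \<in> F \<Longrightarrow> \<bar>f x\<bar> \<le> b f" by metis
  define B where "B = Max (insert 0 (b ` F))"
  have "b f \<le> B" if "f \<in> F" for f using F(1) that by (auto simp: B_def)
  then have B: "\<bar>f x\<bar> \<le> B" if "f \<in> F" for f x using b that by (meson order_trans)
  have "B \<ge> 0" using F(1) by (simp add: B_def)
  obtain \<U> where U: "\<U> \<in> finite_uniform_coverings D"
    "\<And>f x y. f \<in> F \<Longrightarrow> near \<U> x y \<Longrightarrow> \<bar>f x - f y\<bar> \<le> e / 4"
    using finite_common_small_oscillation_covering[OF F, of "e / 4"] e by auto
  define d where "d = e / (4 * (B + 1))"
  have d: "d > 0" "2 * B * d \<le> e / 2"
  proof -
    show "d > 0" using e \<open>B \<ge> 0\<close> by (simp add: d_def)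
    have "2 * B * d \<le> 2 * (B + 1) * d" using \<open>d > 0\<close> by simp
    also have "\<dots> = e / 2" using \<open>B \<ge> 0\<close> by (simp add: d_def field_simps)
    finally show "2 * B * d \<le> e / 2" .
  qed
  \<comment> \<open>The identity makes \<open>\<W>\<close> refine \<open>\<X>\<close>; the inverse of \<open>g\<close> makes the translate by \<open>g\<close> refine \<open>\<X>\<close>.\<close>
  define E' where "E' = insert id (inv_into UNIV ` E)"
  have E': "finite E'" "E' \<subseteq> G" using E action_id action_inv by (auto simp: E'_def)
  obtain \<X> where X: "\<X> \<in> finite_uniform_coverings D" "\<U> \<preceq> \<X>"
    "real (uniform_complexity D (cover_join E' (\<lambda>g. image_family g \<X>)))
      \<le> (1 + d) * real (uniform_complexity D \<X>)"
    using slow E' U(1) d(1) unfolding slow_growth_def by blast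
  obtain \<W> where W: "\<W> \<in> finite_uniform_coverings D" "cover_join E' (\<lambda>g. image_family g \<X>) \<preceq> \<W>"
    "card \<W> = uniform_complexity D (cover_join E' (\<lambda>g. image_family g \<X>))"
    using uniform_complexity_attained[OF cover_join_image_finite_uniform[OF E' X(1)]] .
  have finW: "finite \<W>" using W(1) by (simp add: finite_uniform_coverings_def)
  have "\<W> \<in> D" using W(1) by (simp add: finite_uniform_coverings_def)
  then have "\<W> \<noteq> {}" by (metis coveredE empty_iff)
  have ref: "image_family g \<X> \<preceq> \<W>" if "g \<in> E'" for g
    using cover_join_upper[OF that] W(2) by (rule refined_by_trans)
  have refX: "\<X> \<preceq> \<W>" using ref[of id] by (simp add: E'_def image_family_def)
  \<comment> \<open>An empty member gets an arbitrary point, which is harmless because it is never matched.\<close>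
  define x where "x A = (SOME y. y \<in> A)" for A :: "'a set"
  have x: "x A \<in> A" if "A \<noteq> {}" for A using that by (simp add: x_def some_in_eq)
  have "\<bar>(\<Sum>A\<in>\<W>. f (x A)) - (\<Sum>A\<in>\<W>. f (g (x A)))\<bar> \<le> e * real (card \<W>)" if f: "f \<in> F" and g: "g \<in> E" for f g
  proof -
    have "g \<in> G" using g E(2) by blast
    have refg: "image_family (inv_into UNIV g) \<X> \<preceq> \<W>" using ref g by (simp add: E'_def)
    obtain M where M: "M \<subseteq> \<W> \<times> \<W>" "inj_on fst M" "inj_on snd M" "uniform_complexity D \<X> \<le> card M"
      and meet: "\<forall>(A, B)\<in>M. A \<inter> g ` B \<noteq> {}"
      using large_matching_of_refinement[OF \<open>g \<in> G\<close> X(1) W(1) refX refg] by meson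
    have "\<bar>f (x A) - f (g (x B))\<bar> \<le> e / 2" if AB: "(A, B) \<in> M" for A B
    proof -
      obtain y where y: "y \<in> A" "y \<in> g ` B" using meet AB by fast
      have AB': "A \<in> \<W>" "B \<in> \<W>" using AB M(1) by auto
      obtain V where V: "V \<in> \<X>" "A \<subseteq> V" using refX AB'(1) by (auto simp: refined_by_def)
      obtain V'' where "V'' \<in> image_family (inv_into UNIV g) \<X>" "B \<subseteq> V''"
        using refg AB'(2) unfolding refined_by_def by meson
      then obtain V' where V': "V' \<in> \<X>" "B \<subseteq> inv_into UNIV g ` V'" by (auto simp: image_family_def)
      have "g ` B \<subseteq> V'" using V'(2) \<open>g \<in> G\<close> by auto
      have "x A \<in> A" "x B \<in> B" using x y by auto
      have "near \<X> (x A) y" using V y(1) \<open>x A \<in> A\<close> by (auto intro: nearI)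
      moreover have "near \<X> y (g (x B))"
        using V'(1) y(2) \<open>x B \<in> B\<close> \<open>g ` B \<subseteq> V'\<close> by (intro nearI[of V']) auto
      ultimately show ?thesis
        using U(2)[OF f near_refined[OF X(2)], of "x A" y]
          U(2)[OF f near_refined[OF X(2)], of y "g (x B)"] by linarith
    qed
    then have "\<bar>(\<Sum>A\<in>\<W>. f (x A)) - (\<Sum>A\<in>\<W>. f (g (x A)))\<bar>
        \<le> real (card M) * (e / 2) + 2 * B * (real (card \<W>) - real (card M))"
      using matched_sums_close[OF finW M(1-3), of "\<lambda>A. f (x A)" "\<lambda>A. f (g (x A))" "e / 2" B] B[OF f]
      by blast
    also have "real (card \<W>) - real (card M) \<le> d * real (card M)"
    proof -
      have "real (card \<W>) \<le> (1 + d) * real (uniform_complexity D \<X>)" using X(3) W(3) by simp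
      also have "\<dots> \<le> (1 + d) * real (card M)" using M(4) d(1) by (intro mult_left_mono) auto
      finally show ?thesis by (simp add: algebra_simps)
    qed
    also have "2 * B * (d * real (card M)) = (2 * B * d) * real (card M)" by simp
    also have "\<dots> \<le> e / 2 * real (card M)" using d(2) by (intro mult_right_mono) auto
    also have "real (card M) * (e / 2) + e / 2 * real (card M) = e * real (card M)" by simp
    also have "card M \<le> card \<W>"
      using card_image[OF M(2)] card_mono[OF finW, of "fst ` M"] M(1) by fastforce
    finally show ?thesis using e \<open>B \<ge> 0\<close> by (simp add: mult_left_mono)
  qed
  then show ?thesis using finW \<open>\<W> \<noteq> {}\<close> by blast
qed

lemma finite_average_is_mean:
  assumes "finite W" "W \<noteq> {}"
  shows "is_mean D (\<lambda>f. if f \<in> UC_b D then (\<Sum>w\<in>W. f (x w)) / real (card W) else 0)"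
  unfolding is_mean_def
proof (intro conjI ballI allI)
  have n: "real (card W) > 0" using assms by (simp add: card_gt_0_iff)
  fix f assume f: "f \<in> UC_b D"
  then obtain B where B: "\<And>x. \<bar>f x\<bar> \<le> B" by (auto simp: UC_b_iff)
  have bdd: "bdd_below (range f)" "bdd_above (range f)"
    using B by (auto simp: bdd_below_def bdd_above_def abs_le_iff intro: exI[of _ "- B"] exI[of _ B]) (metis minus_le_iff)
  have "real (card W) * (INF x. f x) \<le> (\<Sum>w\<in>W. f (x w))"
    using bdd(1) by (intro sum_bounded_below cINF_lower) auto
  then show "(INF x. f x) \<le> (if f \<in> UC_b D then (\<Sum>w\<in>W. f (x w)) / real (card W) else 0)"
    using f n by (simp add: pos_le_divide_eq mult.commute)
  have "(\<Sum>w\<in>W. f (x w)) \<le> real (card W) * (SUP x. f x)"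
    using bdd(2) by (intro sum_bounded_above cSUP_upper) auto
  then show "(if f \<in> UC_b D then (\<Sum>w\<in>W. f (x w)) / real (card W) else 0) \<le> (SUP x. f x)"
    using f n by (simp add: pos_divide_le_eq mult.commute)
  show "(if (\<lambda>x. c * f x) \<in> UC_b D then (\<Sum>w\<in>W. c * f (x w)) / real (card W) else 0) =
    c * (if f \<in> UC_b D then (\<Sum>w\<in>W. f (x w)) / real (card W) else 0)" for c
    using f UC_b_scale[OF f] by (simp add: sum_distrib_left)
  fix h assume h: "h \<in> UC_b D"
  show "(if (\<lambda>x. f x + h x) \<in> UC_b D then (\<Sum>w\<in>W. f (x w) + h (x w)) / real (card W) else 0) =
    (if f \<in> UC_b D then (\<Sum>w\<in>W. f (x w)) / real (card W) else 0) +
    (if h \<in> UC_b D then (\<Sum>w\<in>W. h (x w)) / real (card W) else 0)"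
    using f h UC_b_add[OF f h] by (simp add: sum.distrib add_divide_distrib)
qed

text \<open>Tychonoff's theorem: linearity is a closed condition and the bounds confine every value to a
  compact interval. Pinning the values outside \<open>UC_b D\<close> to zero makes all the factors compact.\<close>

lemma compact_means: "compact {m. is_mean D m \<and> (\<forall>f. f \<notin> UC_b D \<longrightarrow> m f = 0)}"
proof -
  define I where "I f = (if f \<in> UC_b D then {(INF x. f x)..(SUP x. f x)} else {0})" for f :: "'a \<Rightarrow> real"
  have "compactin (product_topology (\<lambda>f. euclidean) UNIV) (PiE UNIV I)"
    by (subst compactin_PiE) (auto simp: I_def)
  then have "compact (PiE UNIV I)" by (simp add: euclidean_product_topology)
  moreover have "closed {m :: ('a \<Rightarrow> real) \<Rightarrow> real. m (\<lambda>x. f x + h x) = m f + m h}" for f h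
    by (intro closed_Collect_eq continuous_intros continuous_on_product_coordinates)
  moreover have "closed {m :: ('a \<Rightarrow> real) \<Rightarrow> real. m (\<lambda>x. c * f x) = c * m f}" for f c
    by (intro closed_Collect_eq continuous_intros continuous_on_product_coordinates)
  ultimately have "compact (PiE UNIV I \<inter> ((\<Inter>f\<in>UC_b D. \<Inter>h\<in>UC_b D. {m. m (\<lambda>x. f x + h x) = m f + m h}) \<inter>
      (\<Inter>f\<in>UC_b D. \<Inter>c. {m. m (\<lambda>x. c * f x) = c * m f})))"
    by (intro compact_Int_closed closed_Int closed_INT ballI) auto
  also have "(PiE UNIV I \<inter> ((\<Inter>f\<in>UC_b D. \<Inter>h\<in>UC_b D. {m. m (\<lambda>x. f x + h x) = m f + m h}) \<inter>
      (\<Inter>f\<in>UC_b D. \<Inter>c. {m. m (\<lambda>x. c * f x) = c * m f})))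
    = {m. is_mean D m \<and> (\<forall>f. f \<notin> UC_b D \<longrightarrow> m f = 0)}"
    by (auto simp: is_mean_def I_def PiE_iff split: if_splits)
  finally show ?thesis .
qed

text \<open>The approximate invariance conditions are closed, and finitely many of them are satisfied by a
  finite average. By compactness some mean satisfies all of them.\<close>

lemma amenable_if_slow_growth:
  assumes slow: "slow_growth"
  shows "amenable D G"
proof -
  define K where "K = {m. is_mean D m \<and> (\<forall>f. f \<notin> UC_b D \<longrightarrow> m f = 0)}"
  define C where "C = (\<lambda>(f, g, k). {m :: ('a \<Rightarrow> real) \<Rightarrow> real. \<bar>m (f \<circ> g) - m f\<bar> \<le> 1 / (real k + 1)})"
  have "K \<inter> (\<Inter>i\<in>UC_b D \<times> G \<times> UNIV. C i) \<noteq> {}"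
  proof (rule compact_imp_fip_image)
    show "compact K" unfolding K_def by (rule compact_means)
    show "closed (C i)" for i
      unfolding C_def by (cases i) (simp, intro closed_Collect_le continuous_intros continuous_on_product_coordinates)
    fix I assume I: "finite I" "I \<subseteq> UC_b D \<times> G \<times> (UNIV :: nat set)"
    define F where "F = fst ` I"
    define E where "E = (fst \<circ> snd) ` I"
    obtain n where n: "\<And>k. k \<in> (snd \<circ> snd) ` I \<Longrightarrow> k \<le> n"
      using I(1) by (meson finite_imageI finite_nat_set_iff_bounded_le)
    have "finite F" "F \<subseteq> UC_b D" "finite E" "E \<subseteq> G" using I by (auto simp: F_def E_def)
    then obtain W :: "'a set set" and x where W: "finite W" "W \<noteq> {}"
      "\<And>f g. f \<in> F \<Longrightarrow> g \<in> E \<Longrightarrow> \<bar>(\<Sum>w\<in>W. f (x w)) - (\<Sum>w\<in>W. f (g (x w)))\<bar> \<le> 1 / (real n + 1) * real (card W)"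
      using almost_invariant_finite_average[OF slow \<open>finite F\<close> \<open>F \<subseteq> UC_b D\<close> \<open>finite E\<close> \<open>E \<subseteq> G\<close>,
          of "1 / (real n + 1)"] by (metis add.commute of_nat_0_less_iff of_nat_Suc zero_less_Suc zero_less_divide_1_iff)
    define m where "m f = (if f \<in> UC_b D then (\<Sum>w\<in>W. f (x w)) / real (card W) else 0)" for f
    have "m \<in> K" using finite_average_is_mean[OF W(1,2), of x] by (simp add: K_def m_def[abs_def])
    moreover have "m \<in> C i" if "i \<in> I" for i
    proof -
      obtain f g k where i: "i = (f, g, k)" by (cases i)
      have fg: "f \<in> UC_b D" "g \<in> G" "f \<in> F" "g \<in> E" "k \<le> n"
        using that I(2) n by (force simp: i F_def E_def)+
      have "f \<circ> g \<in> UC_b D" using fg by (intro UC_b_compose action_unif_continuous)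
      then have "\<bar>m (f \<circ> g) - m f\<bar> = \<bar>(\<Sum>w\<in>W. f (x w)) - (\<Sum>w\<in>W. f (g (x w)))\<bar> / real (card W)"
        using fg(1) by (simp add: m_def abs_minus_commute abs_divide flip: diff_divide_distrib)
      also have "\<dots> \<le> 1 / (real n + 1)"
        using W(3)[OF fg(3,4)] W(1,2) by (simp add: pos_divide_le_eq card_gt_0_iff)
      also have "\<dots> \<le> 1 / (real k + 1)" using fg(5) by (simp add: frac_le)
      finally show ?thesis by (simp add: C_def i)
    qed
    ultimately show "K \<inter> (\<Inter>i\<in>I. C i) \<noteq> {}" by blast
  qed
  then obtain m where m: "is_mean D m" "\<And>f g k. f \<in> UC_b D \<Longrightarrow> g \<in> G \<Longrightarrow> \<bar>m (f \<circ> g) - m f\<bar> \<le> 1 / (real k + 1)"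
    by (auto simp: K_def C_def)
  have "m (f \<circ> g) = m f" if "f \<in> UC_b D" "g \<in> G" for f g
  proof (rule ccontr)
    assume "m (f \<circ> g) \<noteq> m f"
    then obtain k where "inverse (real (Suc k)) < \<bar>m (f \<circ> g) - m f\<bar>"
      using reals_Archimedean[of "\<bar>m (f \<circ> g) - m f\<bar>"] by auto
    then show False using m(2)[OF that, of k] by (simp add: inverse_eq_divide add.commute)
  qed
  then show ?thesis using m(1) by (auto simp: amenable_def)
qed

end

theorem theorem7p3:
  fixes D :: "'a set set set" and G :: "('a \<Rightarrow> 'a) set"
  assumes "covering_uniformity D"
    and "perfect_topology (uniform_topology D)"
    and "Hausdorff_space (uniform_topology D)"
    and "subgroup G (Aut D)"
    and "topologically_free D G"
  shows "amenable D G \<longleftrightarrow>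
    (SUP E\<in>{E. finite E \<and> E \<subseteq> G}. SUP \<U>\<in>finite_uniform_coverings D.
       INF \<V>\<in>{\<V> \<in> finite_uniform_coverings D. \<U> \<preceq> \<V>}.
         ereal (real (uniform_complexity D (cover_join E (\<lambda>g. image_family g \<V>)))
                / real (uniform_complexity D \<V>))) = 1"
proof -
  interpret free_perfect_action D G 
    by (intro free_perfect_action.intro uniform_action.intro uniform_covering_space.intro
        uniform_action_axioms.intro free_perfect_action_axioms.intro; fact)
  have "slow_growth" if "amenable D G"
    unfolding slow_growth_def
  proof (intro allI impI)
    fix E \<U> and e :: real
    assume E: "finite E" "E \<subseteq> G" and U: "\<U> \<in> finite_uniform_coverings D" and e: "e > 0"
    show "\<exists>\<X>\<in>finite_uniform_coverings D. \<U> \<preceq> \<X> \<and>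
      real (uniform_complexity D (cover_join E (\<lambda>g. image_family g \<X>)))
        \<le> (1 + e) * real (uniform_complexity D \<X>)"
    proof (cases "E = {}")
      case True
      \<comment> \<open>The empty join is the trivial covering.\<close>
      have "uniform_complexity D (cover_join E (\<lambda>g. image_family g \<U>)) \<le> card {UNIV :: 'a set}"
        using trivial_covering True
        by (intro uniform_complexity_le cover_join_least) (auto simp: finite_uniform_coverings_def)
      then have "real (uniform_complexity D (cover_join E (\<lambda>g. image_family g \<U>))) \<le> 1" by simp
      also have "\<dots> \<le> (1 + e) * real (uniform_complexity D \<U>)"
        using uniform_complexity_pos[OF U] e mult_mono[of 1 "1 + e" 1 "real (uniform_complexity D \<U>)"] by simp
      finally show ?thesis using U refined_by_refl by (intro bexI[of _ \<U>] conjI)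
    next
      case False
      then show ?thesis using slow_growth_if_amenable[OF that E] U e by simp
    qed
  qed
  then have "amenable D G \<longleftrightarrow> slow_growth" using amenable_if_slow_growth by blast
  then show ?thesis using slow_growth_iff by simp
qed

end
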